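(* Let $S$ be a set of abstract vector variables and fix $x\in S$. The finite operators $\partial^{Y,\mathrm R}_{x,q}$ are compatible under inclusions of finite sets $Y\subset Z\subset S\setminus\{x\}$, i.e. $\partial^{Z,\mathrm R}_{x,q}$ restricted to the subalgebra $R_{\mathbb B}(\{x\}\cup Y)\subset R_{\mathbb B}(\{x\}\cup Z)$ equals $\partial^{Y,\mathrm R}_{x,q}$. Consequently, they define a $\mathbb B$-linear operator $$\partial^{\mathrm R}_{x,q}:R_{\mathbb B}(S)\longrightarrow R_{\mathbb B}(S)$$ (restricting to $\partial^{Y,\mathrm R}_{x,q}$ on $R_{\mathbb B}(\{x\}\cup Y)$ for every finite $Y\subset S\setminus\{x\}$), for every radial algebra.
   Context: **Radial algebra.** For a set $S$ of abstract vector variables, $R(S)$ is the associative unital $\mathbb R$-algebra generated by $S$ subject to $[\{u,v\},w]=0$ for all $u,v,w\in S$, where $\{a,b\}=ab+ba$, $[a,b]=ab-ba$. The wedge is the antisymmetrized product $u_1\wedge\cdots\wedge u_p=\frac1{p!}\sum_{\pi}\operatorname{sgn}(\pi)u_{\pi(1)}\cdots u_{\pi(p)}$ (empty wedge $=1$). **Coefficients.** $q,Q$ are algebraically independent indeterminates, $\mathbb B=\mathbb R[q,q^{-1},Q,(1-q)^{-1}]$, $R_{\mathbb B}(S)=\mathbb B\otimes_{\mathbb R}R(S)$. For integers $n,a$: $[n]_q=\frac{1-q^n}{1-q}$, $q^{m+a}:=Qq^a$, $[m+a]_q:=\frac{1-Qq^a}{1-q}$ ($m$ is only a formal symbol). **Scalars.**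 For a finite set $Y=\{y_1,\dots,y_N\}\subset S\setminus\{x\}$, $r=x^2$, $s_i=\{x,y_i\}$, $c_{ij}=\{y_i,y_j\}=c_{ji}$ are central and $\mathcal A_x(Y)=\mathbb B[r,s_1,\dots,s_N,c_{ij}:1\le i\le j\le N]$ is a polynomial algebra. For $I=\{i_1<\cdots<i_p\}\subset\{1,\dots,N\}$, $y_I=y_{i_1}\wedge\cdots\wedge y_{i_p}$, $y_\varnothing=1$. It is known that $R_{\mathbb B}(\{x\}\cup Y)=\bigoplus_I y_I\mathcal A_x(Y)\oplus\bigoplus_I(x\wedge y_I)\mathcal A_x(Y)$, free over $\mathcal A_x(Y)$ on the elements $y_I,\ x\wedge y_I$. **Jackson operators.** For a scalar variable $u$ and parameter $P$: $\delta^{(u)}_Pf=\frac{f(u)-f(Pu)}{(1-P)u}$, $T^{(u)}_Pf(u)=f(Pu)$. The scalar-input operator is $$\partial^{\mathrm{sc},Y}_{x,q}A=(1+q)\,x\,\delta^{(r)}_{q^2}A+2\sum_{i=1}^N y_i\,T^{(r)}_{q^2}\delta^{(s_i)}_qA,\qquad A\in\mathcal A_x(Y).$$ **Finite relative right $q$-vector derivative.** $\partial^{Y,\mathrm R}_{x,q}$ is the $\mathbb B$-linear operator on $R_{\mathbb B}(\{x\}\cup Y)$ defined, for $p=|I|$ and $A,B\in\mathcal A_x(Y)$, by $$\partial^{Y,\mathrm R}_{x,q}(y_IA)=y_I\,\partial^{\mathrm{sc},Y}_{x,q}(A),\qquad \partial^{Y,\mathrm R}_{x,q}((x\wedge y_I)B)=(-1)^p[m-p]_q\,y_IB+q^{m-p}(x\wedge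 y_I)\,\partial^{\mathrm{sc},Y}_{x,q}(B).$$ *)

theory Defs
  imports
    Complex_Main
    "HOL-Library.FuncSet"
    "HOL-Library.Poly_Mapping"
    "HOL-Computational_Algebra.Polynomial"
    "HOL-Computational_Algebra.Fraction_Field"
    "HOL-Combinatorics.Permutations"
begin

section \<open>The coefficient ring\<close>

text \<open>
  The ring \<open>\<real>[q, q\<^sup>-\<^sup>1, Q, (1 - q)\<^sup>-\<^sup>1]\<close> is the subring of \<open>\<real>(q, Q)\<close> generated by the elements
  listed in the brackets. In \<^typ>\<open>real poly poly\<close> the inner variable is \<open>q\<close>, the outer one \<open>Q\<close>.
\<close>

inductive_set coeff_ring :: "real poly poly fract set" where
  const: "Fract [:[:c:]:] 1 \<in> coeff_ring"
| q: "Fract [:[:0, 1:]:] 1 \<in> coeff_ring"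
| q_inverse: "inverse (Fract [:[:0, 1:]:] 1) \<in> coeff_ring"
| Q: "Fract [:0, 1:] 1 \<in> coeff_ring"
| one_minus_q_inverse: "inverse (1 - Fract [:[:0, 1:]:] 1) \<in> coeff_ring"
| add: "a \<in> coeff_ring \<Longrightarrow> b \<in> coeff_ring \<Longrightarrow> a + b \<in> coeff_ring"
| mult: "a \<in> coeff_ring \<Longrightarrow> b \<in> coeff_ring \<Longrightarrow> a * b \<in> coeff_ring"

lemma coeff_ring_0: "0 \<in> coeff_ring"
  using coeff_ring.const[of 0] by (simp add: Zero_fract_def)

lemma coeff_ring_1: "1 \<in> coeff_ring"
  using coeff_ring.const[of 1] by (simp add: One_fract_def one_pCons)

lemma coeff_ring_uminus: "a \<in> coeff_ring \<Longrightarrow> - a \<in> coeff_ring"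
proof -
  assume a: "a \<in> coeff_ring"
  have "Fract [:[:-1:]:] 1 = (- 1 :: real poly poly fract)"
    by (simp add: One_fract_def one_pCons)
  then show ?thesis
    using coeff_ring.mult[OF coeff_ring.const[of "-1"] a] by (simp only: mult_minus1)
qed

typedef coeff = coeff_ring
  using coeff_ring_0 by blast

setup_lifting type_definition_coeff

instantiation coeff :: idom
begin

lift_definition zero_coeff :: coeff is 0 by (rule coeff_ring_0)
lift_definition one_coeff :: coeff is 1 by (rule coeff_ring_1)
lift_definition plus_coeff :: "coeff \<Rightarrow> coeff \<Rightarrow> coeff" is "(+)" by (rule coeff_ring.add)
lift_definition times_coeff :: "coeff \<Rightarrow> coeff \<Rightarrow> coeff" is "(*)" by (rule coeff_ring.mult)
lift_definition uminus_coeff :: "coeff \<Rightarrow> coeff" is uminus by (rule coeff_ring_uminus)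
lift_definition minus_coeff :: "coeff \<Rightarrow> coeff \<Rightarrow> coeff" is "(-)"
  by (metis coeff_ring.add coeff_ring_uminus diff_conv_add_uminus)

instance
  by standard (transfer; simp add: algebra_simps)+

end

instantiation coeff :: real_algebra_1
begin

lift_definition scaleR_coeff :: "real \<Rightarrow> coeff \<Rightarrow> coeff" is "\<lambda>c a. Fract [:[:c:]:] 1 * a"
  by (intro coeff_ring.mult coeff_ring.const)

instance
proof
  show "a *\<^sub>R (x + y) = a *\<^sub>R x + a *\<^sub>R y" for a :: real and x y :: coeff
    by transfer (simp add: algebra_simps)
  show "(a + b) *\<^sub>R x = a *\<^sub>R x + b *\<^sub>R x" for a b :: real and x :: coeff
  proof transfer
    fix a b :: real and x :: "real poly poly fract"
    have "Fract [:[:a + b:]:] 1 = Fract [:[:a:]:] 1 + (Fract [:[:b:]:] 1 :: real poly poly fract)"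
      by simp
    then show "Fract [:[:a + b:]:] 1 * x = Fract [:[:a:]:] 1 * x + Fract [:[:b:]:] 1 * x"
      by (simp only: distrib_right)
  qed
  show "a *\<^sub>R b *\<^sub>R x = (a * b) *\<^sub>R x" for a b :: real and x :: coeff
    by transfer (simp flip: mult.assoc)
  show "1 *\<^sub>R x = x" for x :: coeff
    by transfer (simp flip: one_pCons One_fract_def)
  show "a *\<^sub>R x * y = a *\<^sub>R (x * y)" for a :: real and x y :: coeff
    by transfer (simp add: mult.assoc)
  show "x * a *\<^sub>R y = a *\<^sub>R (x * y)" for a :: real and x y :: coeff
    by transfer (simp add: mult.left_commute)
qed

end

lift_definition cq :: coeff is "Fract [:[:0, 1:]:] 1" by (rule coeff_ring.q)
lift_definition cq_inv :: coeff is "inverse (Fract [:[:0, 1:]:] 1)" by (rule coeff_ring.q_inverse)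
lift_definition cQ :: coeff is "Fract [:0, 1:] 1" by (rule coeff_ring.Q)
lift_definition one_minus_cq_inv :: coeff is "inverse (1 - Fract [:[:0, 1:]:] 1)"
  by (rule coeff_ring.one_minus_q_inverse)

lemma cq_mult_inv: "cq * cq_inv = 1"
  by transfer (rule right_inverse, simp add: Zero_fract_def eq_fract)

lemma one_minus_cq_mult_inv: "(1 - cq) * one_minus_cq_inv = 1"
  by transfer (rule right_inverse, simp add: Zero_fract_def One_fract_def eq_fract one_pCons)

definition q_power :: "int \<Rightarrow> coeff" where
  "q_power a = (if 0 \<le> a then cq ^ nat a else cq_inv ^ nat (- a))"

text \<open>\<open>qm_power a\<close> is \<open>q\<^sup>m\<^sup>+\<^sup>a = Q q\<^sup>a\<close> and \<open>qm_bracket a\<close> is \<open>[m + a]\<^sub>q\<close>, with \<open>m\<close> a formal symbol.\<close>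

definition qm_power :: "int \<Rightarrow> coeff" where
  "qm_power a = cQ * q_power a"

definition qm_bracket :: "int \<Rightarrow> coeff" where
  "qm_bracket a = (1 - qm_power a) * one_minus_cq_inv"


section \<open>Radial algebras\<close>

text \<open>
  Words over \<^typ>\<open>'v\<close> are wrapped in a type of their own, on which \<open>+\<close> is concatenation; then
  \<open>'v fword \<Rightarrow>\<^sub>0 'k\<close> with its convolution product is the free associative unital
  \<open>'k\<close>-algebra on \<^typ>\<open>'v\<close>.
\<close>

datatype 'v fword = FWord (letters: "'v list")

instantiation fword :: (type) monoid_add
begin

definition zero_fword :: "'a fword" where "zero_fword = FWord []"
definition plus_fword :: "'a fword \<Rightarrow> 'a fword \<Rightarrow> 'a fword" where
  "plus_fword u v = FWord (letters u @ letters v)"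

instance
  by standard (auto simp: zero_fword_def plus_fword_def)

end

lemma letters_zero [simp]: "letters 0 = []"
  and letters_plus [simp]: "letters (u + v) = letters u @ letters v"
  by (simp_all add: zero_fword_def plus_fword_def)

definition free_gen :: "'v \<Rightarrow> 'v fword \<Rightarrow>\<^sub>0 'k::comm_ring_1" where
  "free_gen v = Poly_Mapping.single (FWord [v]) 1"

definition free_alg :: "'v set \<Rightarrow> ('v fword \<Rightarrow>\<^sub>0 'k::comm_ring_1) set" where
  "free_alg S = {f. \<forall>w \<in> Poly_Mapping.keys f. set (letters w) \<subseteq> S}"

definition anticomm :: "'a::ring \<Rightarrow> 'a \<Rightarrow> 'a" where
  "anticomm a b = a * b + b * a"

definition comm :: "'a::ring \<Rightarrow> 'a \<Rightarrow> 'a" where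
  "comm a b = a * b - b * a"

text \<open>The two-sided ideal of the free algebra on \<open>S\<close> generated by the defining relations.\<close>

inductive_set radial_ideal :: "'v set \<Rightarrow> ('v fword \<Rightarrow>\<^sub>0 'k::comm_ring_1) set"
  for S :: "'v set" where
  zero: "0 \<in> radial_ideal S"
| rel: "u \<in> S \<Longrightarrow> v \<in> S \<Longrightarrow> w \<in> S \<Longrightarrow>
    comm (anticomm (free_gen u) (free_gen v)) (free_gen w) \<in> radial_ideal S"
| add: "f \<in> radial_ideal S \<Longrightarrow> g \<in> radial_ideal S \<Longrightarrow> f + g \<in> radial_ideal S"
| left: "f \<in> free_alg S \<Longrightarrow> g \<in> radial_ideal S \<Longrightarrow> f * g \<in> radial_ideal S"
| right: "f \<in> radial_ideal S \<Longrightarrow> g \<in> free_alg S \<Longrightarrow> f * g \<in> radial_ideal S"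

lemma free_alg_UNIV [simp]: "free_alg UNIV = UNIV"
  by (simp add: free_alg_def)

lemma radial_ideal_left: "g \<in> radial_ideal UNIV \<Longrightarrow> f * g \<in> radial_ideal UNIV"
  by (rule radial_ideal.left) simp_all

lemma radial_ideal_right: "f \<in> radial_ideal UNIV \<Longrightarrow> f * g \<in> radial_ideal UNIV"
  by (rule radial_ideal.right) simp_all

lemma radial_ideal_uminus: "f \<in> radial_ideal UNIV \<Longrightarrow> - f \<in> radial_ideal UNIV"
  using radial_ideal_left[of f "-1"] by simp

lemma radial_ideal_diff:
  "f \<in> radial_ideal UNIV \<Longrightarrow> g \<in> radial_ideal UNIV \<Longrightarrow> f - g \<in> radial_ideal UNIV"
  using radial_ideal.add[of f UNIV "- g"] radial_ideal_uminus[of g] by simp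

definition radial_eq ::
  "('v fword \<Rightarrow>\<^sub>0 'k::comm_ring_1) \<Rightarrow> ('v fword \<Rightarrow>\<^sub>0 'k) \<Rightarrow> bool" where
  "radial_eq f g \<longleftrightarrow> f - g \<in> radial_ideal UNIV"

text \<open>
  \<open>('k, 'v) radial\<close> is the radial algebra over \<open>'k\<close> on all variables of type \<^typ>\<open>'v\<close>. The
  radial algebra on a set \<open>S\<close> of variables is its subalgebra \<open>radial_on S\<close> below, which by
  \<open>radial_on_presentation\<close> has the presentation with generators \<open>S\<close> and the relations among
  elements of \<open>S\<close> only.
\<close>

quotient_type (overloaded) ('k, 'v) radial = "'v fword \<Rightarrow>\<^sub>0 'k::comm_ring_1" / radial_eq
proof (rule equivpI)
  show "reflp (radial_eq :: ('v fword \<Rightarrow>\<^sub>0 'k) \<Rightarrow> _)"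
    by (auto simp: reflp_def radial_eq_def radial_ideal.zero)
  show "symp (radial_eq :: ('v fword \<Rightarrow>\<^sub>0 'k) \<Rightarrow> _)"
    unfolding symp_def radial_eq_def using radial_ideal_uminus by fastforce
  show "transp (radial_eq :: ('v fword \<Rightarrow>\<^sub>0 'k) \<Rightarrow> _)"
    unfolding transp_def radial_eq_def using radial_ideal.add by fastforce
qed

instantiation radial :: (comm_ring_1, type) ring
begin

lift_definition zero_radial :: "('a, 'b) radial" is 0 .
lift_definition plus_radial :: "('a, 'b) radial \<Rightarrow> ('a, 'b) radial \<Rightarrow> ('a, 'b) radial" is "(+)"
  unfolding radial_eq_def add_diff_add by (rule radial_ideal.add)
lift_definition times_radial :: "('a, 'b) radial \<Rightarrow> ('a, 'b) radial \<Rightarrow> ('a, 'b) radial" is "(*)"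
proof -
  fix f f' g g' :: "'b fword \<Rightarrow>\<^sub>0 'a"
  assume "radial_eq f f'" "radial_eq g g'"
  then have "f * (g - g') + (f - f') * g' \<in> radial_ideal UNIV"
    unfolding radial_eq_def
    by (intro radial_ideal.add radial_ideal_left radial_ideal_right)
  then show "radial_eq (f * g) (f' * g')"
    unfolding radial_eq_def by (simp add: algebra_simps)
qed
lift_definition uminus_radial :: "('a, 'b) radial \<Rightarrow> ('a, 'b) radial" is uminus
  unfolding radial_eq_def minus_diff_minus by (rule radial_ideal_uminus)
lift_definition minus_radial :: "('a, 'b) radial \<Rightarrow> ('a, 'b) radial \<Rightarrow> ('a, 'b) radial" is "(-)"
proof -
  fix f f' g g' :: "'b fword \<Rightarrow>\<^sub>0 'a"
  assume "radial_eq f f'" "radial_eq g g'"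
  then have "(f - f') - (g - g') \<in> radial_ideal UNIV"
    unfolding radial_eq_def by (rule radial_ideal_diff)
  then show "radial_eq (f - g) (f' - g')"
    unfolding radial_eq_def by (simp add: algebra_simps)
qed

instance
  by standard (transfer; simp add: radial_eq_def algebra_simps radial_ideal.zero)+

end

lemma poly_mapping_sum_single:
  "(\<Sum>a \<in> Poly_Mapping.keys f. Poly_Mapping.single a (Poly_Mapping.lookup f a)) = f"
  by (rule poly_mapping_eqI)
    (auto simp: lookup_sum lookup_single when_def in_keys_iff)

lemma poly_mapping_mult_induct:
  fixes F :: "('a::monoid_add \<Rightarrow>\<^sub>0 'k::comm_ring_1) \<Rightarrow> 'b::ring"
  assumes add: "\<And>f g. F (f + g) = F f + F g"
    and single: "\<And>a b c d. F (Poly_Mapping.single a c * Poly_Mapping.single b d) =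
      F (Poly_Mapping.single a c) * F (Poly_Mapping.single b d)"
  shows "F (f * g) = F f * F g"
proof -
  have "F 0 = 0"
    using add[of 0 0] by simp
  then have sum: "F (sum h A) = (\<Sum>i \<in> A. F (h i))" for h :: "'i \<Rightarrow> _" and A
    by (induction A rule: infinite_finite_induct) (simp_all add: add)
  let ?m = "\<lambda>f a. Poly_Mapping.single a (Poly_Mapping.lookup f a)"
  have "F (f * g) = F ((\<Sum>a \<in> Poly_Mapping.keys f. ?m f a) * (\<Sum>b \<in> Poly_Mapping.keys g. ?m g b))"
    by (simp only: poly_mapping_sum_single)
  also have "\<dots> = (\<Sum>a \<in> Poly_Mapping.keys f. F (?m f a)) * (\<Sum>b \<in> Poly_Mapping.keys g. F (?m g b))"
    by (simp only: sum_product sum single)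
  also have "\<dots> = F f * F g"
    by (simp only: flip: sum) (simp only: poly_mapping_sum_single)
  finally show ?thesis .
qed

lemma lookup_mult_zero:
  "Poly_Mapping.lookup (f * g) 0 = Poly_Mapping.lookup f 0 * (Poly_Mapping.lookup g 0)"
  for f :: "'v fword \<Rightarrow>\<^sub>0 'k::comm_ring_1"
proof (rule poly_mapping_mult_induct[of "\<lambda>f. Poly_Mapping.lookup f 0"])
  have "a + b = 0 \<longleftrightarrow> a = 0 \<and> b = 0" for a b :: "'v fword"
    by (cases a; cases b) (auto simp: zero_fword_def plus_fword_def)
  then show "Poly_Mapping.lookup (Poly_Mapping.single a c * Poly_Mapping.single b d) 0 =
      Poly_Mapping.lookup (Poly_Mapping.single a c) 0 * Poly_Mapping.lookup (Poly_Mapping.single b d) 0"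
    for a b :: "'v fword" and c d :: 'k
    by (auto simp: mult_single lookup_single when_def)
qed (simp add: lookup_add)

lemma one_notin_radial_ideal: "(1 :: 'v fword \<Rightarrow>\<^sub>0 'k::comm_ring_1) \<notin> radial_ideal S"
proof -
  have "Poly_Mapping.lookup f 0 = 0" if "f \<in> radial_ideal S" for f :: "'v fword \<Rightarrow>\<^sub>0 'k"
    using that
    by induction
      (simp_all add: lookup_add lookup_minus lookup_mult_zero comm_def anticomm_def algebra_simps)
  then show ?thesis
    by (metis lookup_one_zero zero_neq_one)
qed

instantiation radial :: (comm_ring_1, type) ring_1
begin

lift_definition one_radial :: "('a, 'b) radial" is 1 .

instance
proof
  have "- (1 :: 'b fword \<Rightarrow>\<^sub>0 'a) \<notin> radial_ideal UNIV"
    using radial_ideal_uminus[of "- 1 :: 'b fword \<Rightarrow>\<^sub>0 'a"] one_notin_radial_ideal by auto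
  then show "(0 :: ('a, 'b) radial) \<noteq> 1"
    by transfer (simp add: radial_eq_def)
  show "1 * a = a" "a * 1 = a" for a :: "('a, 'b) radial"
    by (transfer, simp add: radial_eq_def radial_ideal.zero)+
qed

end

lift_definition scal :: "'k \<Rightarrow> ('k::comm_ring_1, 'v) radial" is "Poly_Mapping.single 0" .

lift_definition gen :: "'v \<Rightarrow> ('k::comm_ring_1, 'v) radial" is free_gen .

lemma scal_0 [simp]: "scal 0 = 0" and scal_1 [simp]: "scal 1 = 1"
  by (transfer; simp add: radial_eq_def radial_ideal.zero)+

lemma scal_add: "scal (a + b) = scal a + scal b"
  by transfer (simp add: single_add radial_eq_def radial_ideal.zero)

lemma scal_mult: "scal (a * b) = scal a * scal b"
  by transfer (simp add: mult_single radial_eq_def radial_ideal.zero)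

lemma free_scal_central:
  "Poly_Mapping.single 0 c * f = f * Poly_Mapping.single 0 c"
  for f :: "'v fword \<Rightarrow>\<^sub>0 'k::comm_ring_1"
proof -
  let ?s = "\<Sum>a \<in> Poly_Mapping.keys f. Poly_Mapping.single a (Poly_Mapping.lookup f a)"
  have "Poly_Mapping.single 0 c * ?s = ?s * Poly_Mapping.single 0 c"
    by (simp add: sum_distrib_left sum_distrib_right mult_single mult.commute)
  then show ?thesis
    by (simp only: poly_mapping_sum_single)
qed

lemma scal_central: "scal c * a = a * scal c"
  by transfer (simp add: free_scal_central radial_eq_def radial_ideal.zero)

instantiation radial :: ("{comm_ring_1, real_algebra_1}", type) real_algebra_1
begin

definition scaleR_radial :: "real \<Rightarrow> ('a, 'b) radial \<Rightarrow> ('a, 'b) radial" where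
  "scaleR_radial c a = scal (of_real c) * a"

instance
proof
  show "x * a *\<^sub>R y = a *\<^sub>R (x * y)" for a :: real and x y :: "('a, 'b) radial"
    unfolding scaleR_radial_def by (simp only: scal_central[of _ x] flip: mult.assoc)
qed (simp_all add: scaleR_radial_def distrib_left distrib_right scal_add scal_mult mult.assoc)

end

lemma gen_relation: "comm (anticomm (gen u) (gen v)) (gen w) = 0"
  unfolding comm_def anticomm_def
  by transfer (use radial_ideal.rel[of _ UNIV] in \<open>simp add: radial_eq_def comm_def anticomm_def\<close>)

text \<open>The unital \<open>'k\<close>-subalgebra generated by a set.\<close>

inductive_set subalg :: "('k::comm_ring_1, 'v) radial set \<Rightarrow> ('k, 'v) radial set"
  for G :: "('k, 'v) radial set" where
  scal: "scal c \<in> subalg G"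
| gen: "g \<in> G \<Longrightarrow> g \<in> subalg G"
| add: "a \<in> subalg G \<Longrightarrow> b \<in> subalg G \<Longrightarrow> a + b \<in> subalg G"
| mult: "a \<in> subalg G \<Longrightarrow> b \<in> subalg G \<Longrightarrow> a * b \<in> subalg G"

definition radial_on :: "'v set \<Rightarrow> ('k::comm_ring_1, 'v) radial set" where
  "radial_on S = subalg (gen ` S)"


lift_definition free_restrict ::
  "'v set \<Rightarrow> ('v fword \<Rightarrow>\<^sub>0 'k::comm_ring_1) \<Rightarrow> 'v fword \<Rightarrow>\<^sub>0 'k" is
  "\<lambda>S f w. f w when set (letters w) \<subseteq> S"
  by (erule rev_finite_subset) (auto simp: when_def)

lemma free_restrict_add: "free_restrict S (f + g) = free_restrict S f + free_restrict S g"
  by (rule poly_mapping_eqI) (simp add: free_restrict.rep_eq lookup_add when_def)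

lemma free_restrict_diff: "free_restrict S (f - g) = free_restrict S f - free_restrict S g"
  by (rule poly_mapping_eqI) (simp add: free_restrict.rep_eq lookup_minus when_def)

lemma free_restrict_single:
  "free_restrict S (Poly_Mapping.single w c) =
    (if set (letters w) \<subseteq> S then Poly_Mapping.single w c else 0)"
  by (rule poly_mapping_eqI) (auto simp: free_restrict.rep_eq lookup_single when_def)

lemma free_restrict_mult: "free_restrict S (f * g) = free_restrict S f * free_restrict S g"
  by (rule poly_mapping_mult_induct[of "free_restrict S"])
    (simp_all add: free_restrict_add mult_single free_restrict_single)

lemma free_restrict_in: "free_restrict S f \<in> free_alg S"
  by (auto simp: free_alg_def in_keys_iff free_restrict.rep_eq when_def split: if_splits)

lemma free_restrict_ident: "f \<in> free_alg S \<Longrightarrow> free_restrict S f = f"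
  unfolding free_alg_def
  by (rule poly_mapping_eqI) (auto simp: free_restrict.rep_eq in_keys_iff when_def)

lemma free_alg_add: "f \<in> free_alg S \<Longrightarrow> g \<in> free_alg S \<Longrightarrow> f + g \<in> free_alg S"
  using free_restrict_in[of S "f + g"] by (simp add: free_restrict_add free_restrict_ident)

lemma free_alg_mult: "f \<in> free_alg S \<Longrightarrow> g \<in> free_alg S \<Longrightarrow> f * g \<in> free_alg S"
  using free_restrict_in[of S "f * g"] by (simp add: free_restrict_mult free_restrict_ident)

lemma radial_ideal_restrict:
  fixes f :: "'v fword \<Rightarrow>\<^sub>0 'k::comm_ring_1"
  assumes "f \<in> radial_ideal UNIV"
  shows "free_restrict S f \<in> radial_ideal S"
  using assms
proof induction
  case zero
  show ?case
    using free_restrict_single[of S 0 "0::'k"] radial_ideal.zero[of S] by simp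
next
  case (rel u v w)
  have "free_restrict S (free_gen z :: 'v fword \<Rightarrow>\<^sub>0 'k) = (if z \<in> S then free_gen z else 0)" for z
    by (simp add: free_gen_def free_restrict_single)
  then have "free_restrict S (comm (anticomm (free_gen u) (free_gen v)) (free_gen w)
      :: 'v fword \<Rightarrow>\<^sub>0 'k) =
      (if u \<in> S \<and> v \<in> S \<and> w \<in> S then comm (anticomm (free_gen u) (free_gen v)) (free_gen w) else 0)"
    by (simp add: comm_def anticomm_def free_restrict_add free_restrict_diff free_restrict_mult)
  then show ?case
    by (simp add: radial_ideal.zero radial_ideal.rel)
next
  case (add f g)
  then show ?case
    unfolding free_restrict_add by (intro radial_ideal.add)
next
  case (left f g)
  then show ?case
    unfolding free_restrict_mult by (intro radial_ideal.left free_restrict_in)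
next
  case (right f g)
  then show ?case
    unfolding free_restrict_mult by (intro radial_ideal.right free_restrict_in)
qed

lemma radial_ideal_mono: "f \<in> radial_ideal S \<Longrightarrow> f \<in> radial_ideal UNIV"
proof (induction rule: radial_ideal.induct)
  case (rel u v w)
  show ?case
    by (intro radial_ideal.rel UNIV_I)
qed (rule radial_ideal.zero radial_ideal.add radial_ideal_left radial_ideal_right; assumption)+

lemma abs_radial_single:
  "abs_radial (Poly_Mapping.single w c) = scal c * prod_list (map gen (letters w))"
proof -
  have "abs_radial (Poly_Mapping.single (FWord vs) c) = scal c * prod_list (map gen vs)" for vs
  proof (induction vs rule: rev_induct)
    case Nil
    show ?case
      by (simp add: scal.abs_eq zero_fword_def)
  next
    case (snoc v vs)
    have "Poly_Mapping.single (FWord (vs @ [v])) c = Poly_Mapping.single (FWord vs) c * free_gen v"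
      by (simp add: free_gen_def mult_single plus_fword_def)
    then show ?case
      using snoc by (simp add: gen.abs_eq mult.assoc flip: times_radial.abs_eq)
  qed
  then show ?thesis
    by (cases w) simp
qed

lemma abs_radial_sum: "abs_radial (sum h A) = (\<Sum>i \<in> A. abs_radial (h i))"
  by (induction A rule: infinite_finite_induct)
    (simp_all flip: plus_radial.abs_eq zero_radial.abs_eq)

lemma radial_on_eq_image:
  "(radial_on S :: ('k::comm_ring_1, 'v) radial set) = abs_radial ` free_alg S"
proof (intro equalityI subsetI)
  fix a :: "('k, 'v) radial"
  assume "a \<in> radial_on S"
  then have "a \<in> subalg (gen ` S)"
    by (simp add: radial_on_def)
  then show "a \<in> abs_radial ` free_alg S"
  proof induction
    case (scal c)
    show ?case
      by (intro image_eqI[of _ _ "Poly_Mapping.single 0 c"])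
        (auto simp: scal.abs_eq free_alg_def split: if_splits)
  next
    case (gen g)
    then obtain v where "v \<in> S" "g = gen v"
      by blast
    then show ?case
      by (intro image_eqI[of _ _ "free_gen v"])
        (auto simp: gen.abs_eq free_gen_def free_alg_def)
  next
    case (add a b)
    then obtain f g where "f \<in> free_alg S" "g \<in> free_alg S" "a = abs_radial f" "b = abs_radial g"
      by blast
    then show ?case
      by (intro image_eqI[of _ _ "f + g"]) (simp_all add: plus_radial.abs_eq free_alg_add)
  next
    case (mult a b)
    then obtain f g where "f \<in> free_alg S" "g \<in> free_alg S" "a = abs_radial f" "b = abs_radial g"
      by blast
    then show ?case
      by (intro image_eqI[of _ _ "f * g"]) (simp_all add: times_radial.abs_eq free_alg_mult)
  qed
next
  fix a :: "('k, 'v) radial"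
  assume "a \<in> abs_radial ` free_alg S"
  then obtain f where f: "f \<in> free_alg S" "a = abs_radial f"
    by blast
  have prod: "(prod_list (map gen vs) :: ('k, 'v) radial) \<in> radial_on S" if "set vs \<subseteq> S" for vs
    using that subalg.scal[of 1 "gen ` S"] unfolding radial_on_def
    by (induction vs) (auto intro: subalg.gen subalg.mult)
  have sum: "(\<Sum>w \<in> A. h w) \<in> radial_on S" if "\<And>w. w \<in> A \<Longrightarrow> h w \<in> radial_on S"
    for A and h :: "'v fword \<Rightarrow> ('k, 'v) radial"
    using that subalg.scal[of 0 "gen ` S"] unfolding radial_on_def
    by (induction A rule: infinite_finite_induct) (auto intro: subalg.add)
  have "a = abs_radial (\<Sum>w \<in> Poly_Mapping.keys f. Poly_Mapping.single w (Poly_Mapping.lookup f w))"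
    using f by (simp only: poly_mapping_sum_single)
  also have "\<dots> \<in> radial_on S"
    unfolding abs_radial_sum abs_radial_single
  proof (rule sum)
    fix w
    assume "w \<in> Poly_Mapping.keys f"
    then have "(prod_list (map gen (letters w)) :: ('k, 'v) radial) \<in> radial_on S"
      using f by (intro prod) (auto simp: free_alg_def)
    then show "scal (Poly_Mapping.lookup f w) * prod_list (map gen (letters w)) \<in> radial_on S"
      unfolding radial_on_def by (intro subalg.mult subalg.scal)
  qed
  finally show "a \<in> radial_on S" .
qed

lemma radial_on_presentation:
  "radial_on S = abs_radial ` free_alg S"
  "f \<in> free_alg S \<Longrightarrow> g \<in> free_alg S \<Longrightarrow> abs_radial f = abs_radial g \<longleftrightarrow> f - g \<in> radial_ideal S"
proof -
  show "radial_on S = abs_radial ` free_alg S"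
    by (rule radial_on_eq_image)
  assume "f \<in> free_alg S" "g \<in> free_alg S"
  then have "free_restrict S (f - g) = f - g"
    by (simp add: free_restrict_diff free_restrict_ident)
  then have "f - g \<in> radial_ideal UNIV \<longleftrightarrow> f - g \<in> radial_ideal S"
    using radial_ideal_restrict[of "f - g" S] radial_ideal_mono[of "f - g" S] by auto
  then show "abs_radial f = abs_radial g \<longleftrightarrow> f - g \<in> radial_ideal S"
    by (simp add: radial.abs_eq_iff radial_eq_def)
qed

text \<open>
  The lemmas up to \<open>base_change_universal\<close> say that \<open>('k, 'v) radial\<close> is the tensor product of
  \<open>'k\<close> and \<open>(real, 'v) radial\<close> over the reals: \<open>(b, a) \<mapsto> scal b * base_change a\<close> is the universal
  bilinear map, and it is compatible with products.
\<close>

lift_definition free_base_change ::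
  "('v fword \<Rightarrow>\<^sub>0 real) \<Rightarrow> 'v fword \<Rightarrow>\<^sub>0 'k::{comm_ring_1, real_algebra_1}" is
  "\<lambda>f w. of_real (f w)"
  by (erule rev_finite_subset) auto

lemma free_base_change_add:
  "free_base_change (f + g) = free_base_change f + free_base_change g"
  by (rule poly_mapping_eqI) (simp add: free_base_change.rep_eq lookup_add)

lemma free_base_change_diff:
  "free_base_change (f - g) = free_base_change f - free_base_change g"
  by (rule poly_mapping_eqI) (simp add: free_base_change.rep_eq lookup_minus)

lemma free_base_change_zero: "free_base_change 0 = 0"
  by (rule poly_mapping_eqI) (simp add: free_base_change.rep_eq)

lemma free_base_change_single:
  "free_base_change (Poly_Mapping.single w c) = Poly_Mapping.single w (of_real c)"
  by (rule poly_mapping_eqI) (simp add: free_base_change.rep_eq lookup_single when_def)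

lemma free_base_change_mult:
  "free_base_change (f * g) = free_base_change f * free_base_change g"
  by (rule poly_mapping_mult_induct[of free_base_change])
    (simp_all add: free_base_change_add mult_single free_base_change_single)

lemma free_base_change_gen: "free_base_change (free_gen v) = free_gen v"
  by (simp add: free_gen_def free_base_change_single)

lemma free_base_change_ideal:
  "f \<in> radial_ideal UNIV \<Longrightarrow> free_base_change f \<in> radial_ideal UNIV"
proof (induction rule: radial_ideal.induct)
  case zero
  show ?case
    by (simp add: free_base_change_zero radial_ideal.zero)
next
  case (rel u v w)
  show ?case
    unfolding comm_def anticomm_def free_base_change_add free_base_change_diff
      free_base_change_mult free_base_change_gen
    unfolding comm_def[symmetric] anticomm_def[symmetric]
    by (intro radial_ideal.rel UNIV_I)
qed (simp_all add: free_base_change_add free_base_change_mult radial_ideal.add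
    radial_ideal_left radial_ideal_right)

lift_definition base_change ::
  "(real, 'v) radial \<Rightarrow> ('k::{comm_ring_1, real_algebra_1}, 'v) radial" is free_base_change
  unfolding radial_eq_def by (metis free_base_change_diff free_base_change_ideal)

lemma base_change_add: "base_change (a + b) = base_change a + base_change b"
  by transfer (simp add: free_base_change_add radial_eq_def radial_ideal.zero)

lemma base_change_mult: "base_change (a * b) = base_change a * base_change b"
  by transfer (simp add: free_base_change_mult radial_eq_def radial_ideal.zero)

lemma base_change_scal: "base_change (scal c) = scal (of_real c)"
  by transfer (simp add: free_base_change_single radial_eq_def radial_ideal.zero)

lemma base_change_one: "base_change 1 = 1"
  using base_change_scal[of 1] by simp

lemma base_change_gen: "base_change (gen v) = gen v"
  by transfer (simp add: free_gen_def free_base_change_single radial_eq_def radial_ideal.zero)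

lemma scal_scaleR: "scal (r *\<^sub>R b) = r *\<^sub>R scal b"
  by (simp add: scaleR_radial_def scal_mult scaleR_conv_of_real[of r b])

lemma base_change_scaleR: "base_change (r *\<^sub>R a) = r *\<^sub>R base_change a"
  unfolding scaleR_radial_def base_change_mult base_change_scal by simp

lemma base_change_bilinear:
  "linear (\<lambda>b. scal b * base_change a)" "linear (\<lambda>a. scal b * base_change a)"
proof -
  show "linear (\<lambda>b. scal b * base_change a)"
    by (rule linearI) (simp_all only: scal_add distrib_right scal_scaleR mult_scaleR_left)
  show "linear (\<lambda>a. scal b * base_change a)"
    by (rule linearI)
      (simp_all only: base_change_add distrib_left base_change_scaleR mult_scaleR_right)
qed

lemma base_change_tensor_mult:
  "(scal b * base_change a) * (scal b' * base_change a') = scal (b * b') * base_change (a * a')"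
proof -
  have "scal b * base_change a * (scal b' * base_change a') =
      scal b * (base_change a * scal b') * base_change a'"
    by (simp only: mult.assoc)
  also have "\<dots> = scal b * (scal b' * base_change a) * base_change a'"
    by (simp only: scal_central[of b' "base_change a"])
  also have "\<dots> = scal (b * b') * base_change (a * a')"
    by (simp only: scal_mult base_change_mult mult.assoc)
  finally show ?thesis .
qed

lemma base_change_universal:
  fixes \<phi> :: "'k::{comm_ring_1, real_algebra_1} \<Rightarrow> (real, 'v) radial \<Rightarrow> 'm::real_vector"
  assumes lin1: "\<And>a. linear (\<lambda>b. \<phi> b a)" and lin2: "\<And>b. linear (\<phi> b)"
  shows "\<exists>!\<psi>. linear \<psi> \<and> (\<forall>b a. \<psi> (scal b * base_change a) = \<phi> b a)"
proof -
  define W :: "'v fword \<Rightarrow> (real, 'v) radial" where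
    "W w = abs_radial (Poly_Mapping.single w 1)" for w
  define \<Psi> :: "('v fword \<Rightarrow>\<^sub>0 'k) \<Rightarrow> 'm" where
    "\<Psi> f = (\<Sum>w \<in> Poly_Mapping.keys f. \<phi> (Poly_Mapping.lookup f w) (W w))" for f
  have \<phi>0: "\<phi> 0 a = 0" "\<phi> b 0 = 0" for a b
    using linear_0[OF lin1] linear_0[OF lin2] by simp_all
  have \<phi>_add1: "\<phi> (b + b') a = \<phi> b a + \<phi> b' a" for a b b'
    using linear_add[OF lin1] by simp
  have \<phi>_add2: "\<phi> b (a + a') = \<phi> b a + \<phi> b a'" for a a' b
    using linear_add[OF lin2] by simp
  have \<phi>_scale: "\<phi> (c *\<^sub>R b) a = c *\<^sub>R \<phi> b a" "\<phi> b (c *\<^sub>R a) = c *\<^sub>R \<phi> b a" for a b c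
    using linear_scale[OF lin1] linear_scale[OF lin2] by simp_all
  have \<Psi>_superset: "\<Psi> f = (\<Sum>w \<in> A. \<phi> (Poly_Mapping.lookup f w) (W w))"
    if "finite A" "Poly_Mapping.keys f \<subseteq> A" for f A
    unfolding \<Psi>_def using that
    by (intro sum.mono_neutral_left) (auto simp: in_keys_iff \<phi>0)
  have \<Psi>_add: "\<Psi> (f + g) = \<Psi> f + \<Psi> g" for f g
    by (subst (1 2 3) \<Psi>_superset[of "Poly_Mapping.keys f \<union> Poly_Mapping.keys g"])
      (auto simp: lookup_add \<phi>_add1 sum.distrib dest: keys_add[THEN subsetD])
  have \<Psi>_single: "\<Psi> (Poly_Mapping.single w c) = \<phi> c (W w)" for w c
    by (simp add: \<Psi>_superset[of "{w}"])
  have \<Psi>_0: "\<Psi> 0 = 0"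
    by (simp add: \<Psi>_def)
  have \<Psi>_sum: "\<Psi> (sum h A) = (\<Sum>i \<in> A. \<Psi> (h i))" for h :: "'i \<Rightarrow> _" and A
    by (induction A rule: infinite_finite_induct) (simp_all add: \<Psi>_0 \<Psi>_add)
  let ?bc = "free_base_change :: ('v fword \<Rightarrow>\<^sub>0 real) \<Rightarrow> 'v fword \<Rightarrow>\<^sub>0 'k"
  let ?s = Poly_Mapping.single
  have mult_single_sum: "?s w b * f * ?s w' b' = (\<Sum>v \<in> Poly_Mapping.keys f.
      ?s (w + v + w') (b * Poly_Mapping.lookup f v * b'))"
    for w w' :: "'v fword" and b b' :: "'i::comm_ring_1" and f
  proof -
    have "?s w b * (\<Sum>v \<in> Poly_Mapping.keys f. ?s v (Poly_Mapping.lookup f v)) * ?s w' b' =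
      (\<Sum>v \<in> Poly_Mapping.keys f. ?s (w + v + w') (b * Poly_Mapping.lookup f v * b'))"
      by (simp add: sum_distrib_left sum_distrib_right mult_single)
    then show ?thesis
      by (simp only: poly_mapping_sum_single)
  qed
  have \<Psi>_sandwich: "\<Psi> (?s w b * ?bc r * ?s w' b') =
      \<phi> (b * b') (abs_radial (?s w 1 * r * ?s w' 1))" for w w' b b' r
  proof -
    have scal_W: "abs_radial (?s v c) = c *\<^sub>R W v" for v :: "'v fword" and c :: real
      by (simp add: W_def scaleR_radial_def abs_radial_single)
    have keys: "Poly_Mapping.keys (?bc r) = Poly_Mapping.keys r"
      by (auto simp: in_keys_iff free_base_change.rep_eq)
    have "b * of_real c * b' = c *\<^sub>R (b * b')" for c
      by (simp add: scaleR_conv_of_real mult_ac)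
    then show ?thesis
      by (simp add: mult_single_sum \<Psi>_sum \<Psi>_single abs_radial_sum scal_W keys
          free_base_change.rep_eq linear_sum[OF lin2] \<phi>_scale)
  qed
  have \<Psi>_ideal: "\<Psi> (g * f * h) = 0" if "f \<in> radial_ideal UNIV" for f g h
    using that
  proof (induction arbitrary: g h)
    case zero
    show ?case
      by (simp add: \<Psi>_0)
  next
    case (rel u v w)
    let ?r = "comm (anticomm (free_gen u) (free_gen v)) (free_gen w) :: 'v fword \<Rightarrow>\<^sub>0 real"
    have r: "comm (anticomm (free_gen u) (free_gen v)) (free_gen w) = ?bc ?r"
      by (simp add: comm_def anticomm_def free_gen_def free_base_change_add free_base_change_diff
          free_base_change_mult free_base_change_single)
    have r0: "abs_radial ?r = 0"
      unfolding zero_radial.abs_eq using radial_ideal.rel[of u UNIV v w]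
      by (simp add: radial.abs_eq_iff radial_eq_def)
    have "\<Psi> ((\<Sum>a \<in> Poly_Mapping.keys g. ?s a (Poly_Mapping.lookup g a)) * ?bc ?r *
        (\<Sum>a \<in> Poly_Mapping.keys h. ?s a (Poly_Mapping.lookup h a))) = 0"
      by (simp add: sum_distrib_left sum_distrib_right \<Psi>_sum \<Psi>_sandwich r0 \<phi>0
          flip: times_radial.abs_eq)
    then show ?case
      unfolding r by (simp only: poly_mapping_sum_single)
  next
    case (add f f')
    then show ?case
      by (simp add: distrib_left distrib_right \<Psi>_add)
  next
    case (left f f')
    then show ?case
      using left.IH[of "g * f" h] by (simp add: mult.assoc)
  next
    case (right f f')
    then show ?case
      using right.IH[of g "f' * h"] by (simp add: mult.assoc)
  qed
  have \<Psi>_eq: "\<Psi> f = \<Psi> g" if "radial_eq f g" for f g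
    using \<Psi>_ideal[of "f - g" 1 1] \<Psi>_add[of "f - g" g] that by (simp add: radial_eq_def)
  define \<psi> where "\<psi> a = \<Psi> (rep_radial a)" for a
  have \<psi>_abs: "\<psi> (abs_radial f) = \<Psi> f" for f
    unfolding \<psi>_def by (rule \<Psi>_eq) (metis radial.abs_eq_iff Quotient_radial Quotient_abs_rep)
  have \<psi>_add: "\<psi> (a + b) = \<psi> a + \<psi> b" for a b
    by (induction a; induction b) (simp add: \<psi>_abs plus_radial.abs_eq \<Psi>_add)
  have expand: "\<exists>A B. finite A \<and> a = (\<Sum>w \<in> A. scal (B w) * base_change (W w))"
    for a :: "('k, 'v) radial"
  proof (induction a)
    case (1 f)
    have "abs_radial (\<Sum>w \<in> Poly_Mapping.keys f. ?s w (Poly_Mapping.lookup f w)) =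
      (\<Sum>w \<in> Poly_Mapping.keys f. scal (Poly_Mapping.lookup f w) * base_change (W w))"
      by (simp add: abs_radial_sum W_def base_change.abs_eq free_base_change_single)
        (simp add: abs_radial_single)
    then have "abs_radial f =
      (\<Sum>w \<in> Poly_Mapping.keys f. scal (Poly_Mapping.lookup f w) * base_change (W w))"
      by (simp only: poly_mapping_sum_single)
    then show ?case
      by (intro exI[of _ "Poly_Mapping.keys f"] exI[of _ "Poly_Mapping.lookup f"]) simp
  qed
  have \<psi>_tensor: "\<psi> (scal b * base_change a) = \<phi> b a" for a b
  proof (induction a)
    case (1 f)
    have "\<psi> (scal b * base_change (abs_radial f)) = \<Psi> (?s 0 b * ?bc f * ?s 0 1)"
      by (simp add: scal.abs_eq base_change.abs_eq times_radial.abs_eq \<psi>_abs)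
    also have "\<dots> = \<phi> (b * 1) (abs_radial (?s 0 1 * f * ?s 0 1))"
      by (rule \<Psi>_sandwich)
    finally show ?case
      by simp
  qed
  have \<psi>_linear: "linear \<psi>"
  proof (rule linearI)
    show "\<psi> (r *\<^sub>R a) = r *\<^sub>R \<psi> a" for r a
    proof -
      obtain A B where A: "finite A" "a = (\<Sum>w \<in> A. scal (B w) * base_change (W w))"
        using expand by blast
      have \<psi>_sum: "\<psi> (sum h A) = (\<Sum>i \<in> A. \<psi> (h i))" for h
        using A(1) \<psi>_add[of 0 0] by (induction A) (simp_all add: \<psi>_add)
      have "r *\<^sub>R (scal b * base_change c) = scal (r *\<^sub>R b) * base_change c"
        for b :: 'k and c :: "(real, 'v) radial"
        by (simp add: scaleR_radial_def scaleR_conv_of_real scal_mult mult.assoc)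
      then show ?thesis
        by (simp add: A(2) scaleR_sum_right \<psi>_sum \<psi>_tensor \<phi>_scale)
    qed
  qed (rule \<psi>_add)
  show ?thesis
  proof (rule ex1I[of _ \<psi>])
    show "linear \<psi> \<and> (\<forall>b a. \<psi> (scal b * base_change a) = \<phi> b a)"
      by (intro conjI allI \<psi>_linear \<psi>_tensor)
  next
    fix \<psi>'
    assume \<psi>': "linear \<psi>' \<and> (\<forall>b a. \<psi>' (scal b * base_change a) = \<phi> b a)"
    show "\<psi>' = \<psi>"
    proof
      fix a :: "('k, 'v) radial"
      obtain A B where a: "a = (\<Sum>w \<in> A. scal (B w) * base_change (W w))"
        using expand[of a] by (elim exE conjE)
      have "\<psi>' a = (\<Sum>w \<in> A. \<psi>' (scal (B w) * base_change (W w)))"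
        unfolding a by (rule linear_sum) (use \<psi>' in blast)
      also have "\<dots> = (\<Sum>w \<in> A. \<psi> (scal (B w) * base_change (W w)))"
        by (simp only: \<psi>' \<psi>_tensor)
      also have "\<dots> = \<psi> a"
        unfolding a by (rule linear_sum[OF \<psi>_linear, symmetric])
      finally show "\<psi>' a = \<psi> a" .
    qed
  qed
qed


section \<open>Wedge products\<close>

definition wedge :: "'a::real_algebra_1 list \<Rightarrow> 'a" where
  "wedge us = (1 / fact (length us)) *\<^sub>R
    (\<Sum>\<pi> | \<pi> permutes {..<length us}.
      of_int (sign \<pi>) * prod_list (map (\<lambda>i. us ! \<pi> i) [0..<length us]))"


section \<open>Scalars and Jackson operators\<close>

text \<open>The elements \<open>r\<close>, \<open>s\<^sub>i\<close> and \<open>c\<^sub>i\<^sub>j\<close>; the algebra \<open>\<A>\<^sub>x(Y)\<close> is \<open>subalg (scalar_gens x Y)\<close>.\<close>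

definition scalar_gens :: "'v \<Rightarrow> 'v set \<Rightarrow> (coeff, 'v) radial set" where
  "scalar_gens x Y = {(gen x)\<^sup>2} \<union> {anticomm (gen x) (gen y) | y. y \<in> Y} \<union>
    {anticomm (gen y) (gen z) | y z. y \<in> Y \<and> z \<in> Y}"

text \<open>
  In the following operators \<open>G\<close> is a set of independent variables of the polynomial algebra
  \<open>subalg G\<close> and \<open>u\<close> is one of these variables. \<open>dilation G u P\<close> is \<open>f(u) \<mapsto> f(Pu)\<close>, i.e. the
  substitution of \<open>Pu\<close> for \<open>u\<close> with all other variables fixed.
\<close>

definition dilation ::
  "(coeff, 'v) radial set \<Rightarrow> (coeff, 'v) radial \<Rightarrow> coeff \<Rightarrow> (coeff, 'v) radial \<Rightarrow> (coeff, 'v) radial"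
where
  "dilation G u P = (THE T. T \<in> subalg G \<rightarrow>\<^sub>E subalg G \<and>
    (\<forall>c. T (scal c) = scal c) \<and>
    (\<forall>f\<in>subalg G. \<forall>g\<in>subalg G. T (f + g) = T f + T g \<and> T (f * g) = T f * T g) \<and>
    T u = scal P * u \<and>
    (\<forall>g\<in>G - {u}. T g = g))"

definition jackson ::
  "(coeff, 'v) radial set \<Rightarrow> (coeff, 'v) radial \<Rightarrow> coeff \<Rightarrow> (coeff, 'v) radial \<Rightarrow> (coeff, 'v) radial"
where
  "jackson G u P f = (THE g. g \<in> subalg G \<and> scal (1 - P) * u * g = f - dilation G u P f)"

definition scalar_qderiv :: "'v \<Rightarrow> 'v set \<Rightarrow> (coeff, 'v) radial \<Rightarrow> (coeff, 'v) radial" where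
  "scalar_qderiv x Y A =
    (let G = scalar_gens x Y; r = (gen x)\<^sup>2 in
      scal (1 + cq) * gen x * jackson G r (cq\<^sup>2) A +
      2 * (\<Sum>y\<in>Y. gen y * dilation G r (cq\<^sup>2) (jackson G (anticomm (gen x) (gen y)) cq A)))"


section \<open>The finite relative right \<open>q\<close>-vector derivative\<close>

definition coeff_linear_on ::
  "(coeff, 'v) radial set \<Rightarrow> ((coeff, 'v) radial \<Rightarrow> (coeff, 'v) radial) \<Rightarrow> bool" where
  "coeff_linear_on V D \<longleftrightarrow>
    (\<forall>a\<in>V. \<forall>b\<in>V. D (a + b) = D a + D b) \<and> (\<forall>c. \<forall>a\<in>V. D (scal c * a) = scal c * D a)"

text \<open>
  The finite set \<open>Y = {y\<^sub>1, \<dots>, y\<^sub>N}\<close> is given by its enumeration, the distinct list \<open>ys\<close>. An index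
  set \<open>I\<close> is a set of positions in \<open>ys\<close> (counted from \<open>0\<close>), and \<open>nths ys I\<close> lists the entries of
  \<open>ys\<close> at these positions in increasing order.
\<close>

definition finite_qderiv :: "'v \<Rightarrow> 'v list \<Rightarrow> (coeff, 'v) radial \<Rightarrow> (coeff, 'v) radial" where
  "finite_qderiv x ys =
    (let V = radial_on (insert x (set ys));
         \<A> = subalg (scalar_gens x (set ys));
         dsc = scalar_qderiv x (set ys);
         y = (\<lambda>I. wedge (map gen (nths ys I)));
         xy = (\<lambda>I. wedge (gen x # map gen (nths ys I)))
     in THE D. D \<in> V \<rightarrow>\<^sub>E V \<and> coeff_linear_on V D \<and>
       (\<forall>I. I \<subseteq> {..<length ys} \<longrightarrow>
         (\<forall>A\<in>\<A>. D (y I * A) = y I * dsc A) \<and>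
         (\<forall>B\<in>\<A>. D (xy I * B) =
           (- 1) ^ card I * scal (qm_bracket (- int (card I))) * y I * B +
           scal (qm_power (- int (card I))) * xy I * dsc B)))"

end

theory Submission
  imports Defs
begin

text \<open>
  The radial algebra on \<open>x\<close> and finitely many other variables acts on a generic Clifford module
  whose coefficients are polynomials in independent variables indexed by \<open>r\<close>, \<open>s\<^sub>i\<close>, \<open>c\<^sub>i\<^sub>j\<close>. The
  scalars act by multiplication with their own polynomials, hence they are algebraically
  independent and dilations and Jackson operators exist. An ordered product of letters moves the
  vacuum to a basis vector of the module, and a wedge product equals the corresponding ordered
  product up to shorter words, so that wedge products form a basis over the scalars by
  triangularity. Hence the finite operators exist, and two of them can be compared on
  this basis: reordering the variables multiplies \<open>y\<^sub>I\<close> and \<open>x \<and> y\<^sub>I\<close> by the same sign, and scalars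
  in the smaller set of variables do not involve the additional \<open>s\<^sub>i\<close>. Finally, every element of
  the radial algebra lives on finitely many variables.
\<close>


text \<open>\<open>dilation\<close>, \<open>jackson\<close> and \<open>finite_qderiv\<close> are
  definite descriptions, so nothing can be said about them before existence and uniqueness are
  shown; both rest on the scalars being polynomials and on freeness over them. Spanning follows from
  the defining relations, but independence needs a representation in which the scalars act as true
  indeterminates. The variables of the coefficient polynomials are indexed by the elements r, s_i,
  c_ij of the radial algebra themselves. Thus c_ij and c_ji are automatically one variable, and
  evaluating every variable at itself turns the polynomial by which a scalar acts back into that
  scalar. A finite set of variables is given by a list, and the order of the list enters the
  formulas for wedge products. Compatibility therefore includes independence of the enumeration, as
  the case of two lists with the same entries.\<close>

lemma subalg_0: "0 \<in> subalg G"
  using subalg.scal[of 0] by simp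

lemma subalg_1: "1 \<in> subalg G"
  using subalg.scal[of 1] by simp

lemma scal_uminus: "scal (- c) = - scal c"
  using scal_add[of "- c" c] by (simp add: eq_neg_iff_add_eq_0)

lemma subalg_uminus:
  assumes "a \<in> subalg G"
  shows "- a \<in> subalg G"
  using subalg.mult[OF subalg.scal[of "-1"] assms] by (simp add: scal_uminus)

lemma subalg_diff: "a \<in> subalg G \<Longrightarrow> b \<in> subalg G \<Longrightarrow> a - b \<in> subalg G"
  using subalg.add[OF _ subalg_uminus] by fastforce

lemma subalg_sum: "(\<And>i. i \<in> I \<Longrightarrow> f i \<in> subalg G) \<Longrightarrow> sum f I \<in> subalg G"
  by (induction I rule: infinite_finite_induct) (simp_all add: subalg_0 subalg.add)

lemma subalg_subset: "G \<subseteq> subalg H \<Longrightarrow> subalg G \<subseteq> subalg H"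
proof
  fix a
  assume "G \<subseteq> subalg H" "a \<in> subalg G"
  from this(2,1) show "a \<in> subalg H"
    by induction (auto intro: subalg.intros)
qed

lemma subalg_mono: "G \<subseteq> H \<Longrightarrow> subalg G \<subseteq> subalg H"
  by (rule subalg_subset) (auto intro: subalg.gen)

lemma radial_on_mono: "S \<subseteq> T \<Longrightarrow> radial_on S \<subseteq> radial_on T"
  unfolding radial_on_def by (rule subalg_mono) auto

lemma radial_on_UNIV: "a \<in> radial_on UNIV"
  unfolding radial_on_eq_image by (induction a) simp

lemma radial_on_finite:
  assumes "a \<in> radial_on S"
  shows "\<exists>T. finite T \<and> T \<subseteq> S \<and> a \<in> radial_on T"
  using assms unfolding radial_on_def
proof induction
  case (scal c)
  show ?case
    by (intro exI[of _ "{}"]) (simp add: subalg.scal)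
next
  case (gen g)
  then obtain v where "v \<in> S" "g = gen v"
    by blast
  then show ?case
    by (intro exI[of _ "{v}"]) (auto intro: subalg.gen)
next
  case (add a b)
  then obtain T T' where "finite (T \<union> T')" "T \<union> T' \<subseteq> S"
    "a \<in> subalg (gen ` T)" "b \<in> subalg (gen ` T')"
    by blast
  then show ?case
    by (intro exI[of _ "T \<union> T'"]) (metis Un_upper1 Un_upper2 image_mono subalg.add subalg_mono subsetD)
next
  case (mult a b)
  then obtain T T' where "finite (T \<union> T')" "T \<union> T' \<subseteq> S"
    "a \<in> subalg (gen ` T)" "b \<in> subalg (gen ` T')"
    by blast
  then show ?case
    by (intro exI[of _ "T \<union> T'"]) (metis Un_upper1 Un_upper2 image_mono subalg.mult subalg_mono subsetD)
qed

lemma gen_in_radial_on: "v \<in> S \<Longrightarrow> gen v \<in> radial_on S"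
  unfolding radial_on_def by (intro subalg.gen imageI)

section \<open>Central elements and the algebra of scalars\<close>

definition central :: "('k::comm_ring_1, 'v) radial \<Rightarrow> bool" where
  "central a \<longleftrightarrow> (\<forall>b. a * b = b * a)"

lemma centralD: "central a \<Longrightarrow> a * b = b * a"
  by (simp add: central_def)

lemma central_left_commute: "central a \<Longrightarrow> a * (b * c) = b * (a * c)"
  by (metis central_def mult.assoc)

lemma central_scal: "central (scal c)"
  by (simp add: central_def scal_central)

lemma central_mult: "central a \<Longrightarrow> central b \<Longrightarrow> central (a * b)"
  unfolding central_def by (metis mult.assoc)

lemma central_add: "central a \<Longrightarrow> central b \<Longrightarrow> central (a + b)"
  by (simp add: central_def distrib_left distrib_right)

lemma central_subalg:
  assumes "a \<in> subalg G" "\<And>g. g \<in> G \<Longrightarrow> central g"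
  shows "central a"
  using assms
proof induction
qed (auto intro: central_scal central_add central_mult)

text \<open>The elements commuting with \<open>a\<close> form a subalgebra, and the generators
  generate the whole algebra.\<close>

lemma central_iff_gen: "central a \<longleftrightarrow> (\<forall>v. a * gen v = gen v * a)"
proof
  assume *: "\<forall>v. a * gen v = gen v * a"
  have "a * b = b * a" if "b \<in> subalg (range gen)" for b
    using that
  proof induction
    case (scal c)
    show ?case
      by (simp add: scal_central)
  next
    case (mult b c)
    then show ?case
      by (metis mult.assoc)
  qed (use * in \<open>auto simp: distrib_left distrib_right\<close>)
  then show "central a"
    using radial_on_UNIV unfolding central_def radial_on_def by blast
qed (simp add: central_def)

lemma central_anticomm: "central (anticomm (gen u) (gen v))"
  using gen_relation unfolding central_iff_gen comm_def by fastforce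

lemma anticomm_commute: "anticomm a b = anticomm b a"
  by (simp add: anticomm_def add.commute)

lemma gen_square: "(gen v)\<^sup>2 = (1 / 2) *\<^sub>R anticomm (gen v) (gen v)"
  by (simp add: anticomm_def power2_eq_square flip: scaleR_left_distrib scaleR_2)

lemma central_square: "central ((gen v)\<^sup>2 :: ('k::{comm_ring_1, real_algebra_1}, 'v) radial)"
  unfolding gen_square scaleR_radial_def by (intro central_mult central_scal central_anticomm)

abbreviation scalars :: "'v \<Rightarrow> 'v set \<Rightarrow> (coeff, 'v) radial set" where
  "scalars x Y \<equiv> subalg (scalar_gens x Y)"

lemma central_scalar_gens: "g \<in> scalar_gens x Y \<Longrightarrow> central g"
  unfolding scalar_gens_def by (auto simp: central_square central_anticomm)

lemma central_scalars: "a \<in> scalars x Y \<Longrightarrow> central a"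
  by (erule central_subalg) (rule central_scalar_gens)

lemma scalar_gens_mono: "Y \<subseteq> Z \<Longrightarrow> scalar_gens x Y \<subseteq> scalar_gens x Z"
  unfolding scalar_gens_def by blast

lemma scalars_mono: "Y \<subseteq> Z \<Longrightarrow> scalars x Y \<subseteq> scalars x Z"
  by (intro subalg_mono scalar_gens_mono)

lemma anticomm_in_scalars:
  assumes "u \<in> insert x Y" "v \<in> insert x Y"
  shows "anticomm (gen u) (gen v) \<in> scalars x Y"
proof -
  \<comment> \<open>The generating set contains r = x^2 in place of {x, x} = 2 r; every other
    anticommutator of letters is itself a generator.\<close>
  have x: "anticomm (gen x) (gen x) \<in> scalars x Y"
  proof -
    have "anticomm (gen x) (gen x) = (gen x)\<^sup>2 + ((gen x)\<^sup>2 :: (coeff, 'a) radial)"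
      by (simp add: anticomm_def power2_eq_square)
    moreover have "(gen x)\<^sup>2 \<in> scalars x Y"
      by (rule subalg.gen) (simp add: scalar_gens_def)
    ultimately show ?thesis
      by (simp add: subalg.add)
  qed
  have "anticomm (gen u) (gen v) \<in> scalar_gens x Y" if uv: "u \<noteq> x \<or> v \<noteq> x"
  proof -
    consider "u = x" "v \<in> Y" | "v = x" "u \<in> Y" | "u \<in> Y" "v \<in> Y"
      using assms uv by blast
    then show ?thesis
      unfolding scalar_gens_def by cases (use anticomm_commute in blast)+
  qed
  then show ?thesis
    using x by (cases "u = x \<and> v = x") (auto intro: subalg.gen)
qed

lemma scalars_subset_radial_on: "scalars x Y \<subseteq> radial_on (insert x Y)"
  unfolding radial_on_def
proof (rule subalg_subset)
  show "scalar_gens x Y \<subseteq> subalg (gen ` insert x Y)"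
    unfolding scalar_gens_def anticomm_def power2_eq_square
    using subalg.gen[of _ "gen ` insert x Y"] by (auto intro!: subalg.add subalg.mult)
qed


section \<open>Evaluation of polynomials at central elements\<close>

text \<open>Multisets of variables are the monomials, so the convolution product is multiplication
  of polynomials. Later \<open>'g\<close> is the radial algebra itself, each scalar generator
  serving as its own variable.\<close>

type_synonym 'g mpoly = "'g multiset \<Rightarrow>\<^sub>0 coeff"

abbreviation mconst :: "coeff \<Rightarrow> 'g mpoly" where
  "mconst c \<equiv> Poly_Mapping.single {#} c"

abbreviation mvar :: "'g \<Rightarrow> 'g mpoly" where
  "mvar g \<equiv> Poly_Mapping.single {#g#} 1"

text \<open>Addition of multisets is cancellative, so a monomial merely shifts coefficients. As
  \<open>coeff\<close> is a domain, non-zero monomials are therefore not zero divisors, the source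
  of uniqueness for Jackson quotients.\<close>

lemma lookup_single_mult:
  fixes p :: "'g mpoly"
  shows "Poly_Mapping.lookup (Poly_Mapping.single M c * p) (M + N) = c * Poly_Mapping.lookup p N"
proof -
  have "Poly_Mapping.lookup (Poly_Mapping.single M c * (\<Sum>K \<in> Poly_Mapping.keys p.
      Poly_Mapping.single K (Poly_Mapping.lookup p K))) (M + N) = c * Poly_Mapping.lookup p N"
    by (simp add: sum_distrib_left mult_single lookup_sum lookup_single when_def in_keys_iff)
  then show ?thesis
    by (simp only: poly_mapping_sum_single)
qed

lemma single_mult_eq_0:
  fixes p :: "'g mpoly"
  assumes "Poly_Mapping.single M c * p = 0" "c \<noteq> 0"
  shows "p = 0"
  using assms lookup_single_mult[of M c p] by (intro poly_mapping_eqI) simp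

text \<open>Replacing non-central values by \<open>1\<close> makes the fold independent of the order of the factors.\<close>

definition eval_monom :: "('g \<Rightarrow> (coeff, 'v) radial) \<Rightarrow> 'g multiset \<Rightarrow> (coeff, 'v) radial" where
  "eval_monom h M = fold_mset (\<lambda>g a. (if central (h g) then h g else 1) * a) 1 M"

definition eval_poly :: "('g \<Rightarrow> (coeff, 'v) radial) \<Rightarrow> 'g mpoly \<Rightarrow> (coeff, 'v) radial" where
  "eval_poly h p = (\<Sum>M \<in> Poly_Mapping.keys p. scal (Poly_Mapping.lookup p M) * eval_monom h M)"

lemma central_1: "central 1"
  by (simp add: central_def)

lemma eval_monom_add_mset:
  "eval_monom h (add_mset g M) = (if central (h g) then h g else 1) * eval_monom h M"
proof -
  let ?h = "\<lambda>g. if central (h g) then h g else 1"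
  have central: "central (?h g)" for g
    by (simp add: central_1)
  interpret comp_fun_commute "\<lambda>g a. ?h g * a"
    by unfold_locales (rule ext, unfold o_apply, rule central_left_commute[OF central])
  show ?thesis
    unfolding eval_monom_def by (rule fold_mset_add_mset)
qed

lemma eval_monom_empty: "eval_monom h {#} = 1"
  by (simp add: eval_monom_def)

lemma eval_monom_add: "eval_monom h (M + N) = eval_monom h M * eval_monom h N"
  by (induction M) (simp_all add: eval_monom_empty eval_monom_add_mset mult.assoc)

lemma eval_poly_single: "eval_poly h (Poly_Mapping.single M c) = scal c * eval_monom h M"
  by (simp add: eval_poly_def)

lemma eval_poly_add: "eval_poly h (p + p') = eval_poly h p + eval_poly h p'"
proof -
  have superset: "eval_poly h f = (\<Sum>M \<in> A. scal (Poly_Mapping.lookup f M) * eval_monom h M)"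
    if "finite A" "Poly_Mapping.keys f \<subseteq> A" for f A
    unfolding eval_poly_def using that
    by (intro sum.mono_neutral_left) (auto simp: in_keys_iff)
  show ?thesis
    by (subst (1 2 3) superset[of "Poly_Mapping.keys p \<union> Poly_Mapping.keys p'"])
      (auto simp: lookup_add scal_add distrib_right sum.distrib dest: keys_add[THEN subsetD])
qed

lemma eval_poly_mult: "eval_poly h (p * p') = eval_poly h p * eval_poly h p'"
proof (rule poly_mapping_mult_induct)
  show "eval_poly h (Poly_Mapping.single M c * Poly_Mapping.single N d) =
      eval_poly h (Poly_Mapping.single M c) * eval_poly h (Poly_Mapping.single N d)" for M c N d
  proof -
    have "scal d * (eval_monom h M * eval_monom h N) = eval_monom h M * (scal d * eval_monom h N)"
      by (rule central_left_commute[OF central_scal])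
    then show ?thesis
      by (simp add: mult_single eval_poly_single scal_mult eval_monom_add mult.assoc)
  qed
qed (rule eval_poly_add)

lemma eval_poly_mconst: "eval_poly h (mconst c) = scal c"
  by (simp add: eval_poly_single eval_monom_empty)

lemma eval_poly_mvar: "central (h g) \<Longrightarrow> eval_poly h (mvar g) = h g"
  by (simp add: eval_poly_single eval_monom_add_mset eval_monom_empty)


section \<open>A Clifford module\<close>

text \<open>
  The functions on sets of positions in \<open>xs\<close> form a Clifford module over the commutative ring
  \<open>'p\<close>. Adjoining a generator \<open>v\<close> to a module \<open>M\<close> gives \<open>M \<oplus> v M\<close>, with \<open>v (a + v b) = v\<^sup>2 b + v a\<close>
  and \<open>u (a + v b) = (u a + {u, v} b) - v (u b)\<close>. Position \<open>0\<close> belongs to \<open>I\<close> iff \<open>I\<close> indexes a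
  coefficient of the second summand.
\<close>

primrec clifford ::
  "('v \<Rightarrow> 'p::comm_ring_1) \<Rightarrow> ('v \<Rightarrow> 'v \<Rightarrow> 'p) \<Rightarrow> 'v list \<Rightarrow> 'v \<Rightarrow> (nat set \<Rightarrow> 'p) \<Rightarrow> nat set \<Rightarrow> 'p"
where
  "clifford sq pol [] u f = (\<lambda>_. 0)"
| "clifford sq pol (v # xs) u f = (\<lambda>I.
    let J = Suc -` I; a = (\<lambda>J. f (Suc ` J)); b = (\<lambda>J. f (insert 0 (Suc ` J))) in
    if 0 \<in> I then (if u = v then a J else - clifford sq pol xs u b J)
    else (if u = v then sq v * b J else clifford sq pol xs u a J + pol u v * b J))"

lemma vimage_Suc_insert: "Suc -` insert 0 (Suc ` J) = J" "Suc -` Suc ` J = J"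
  by auto

lemma clifford_Suc:
  "clifford sq pol (v # xs) u f (Suc ` J) =
    (if u = v then sq v * f (insert 0 (Suc ` J))
     else clifford sq pol xs u (\<lambda>J. f (Suc ` J)) J + pol u v * f (insert 0 (Suc ` J)))"
  "clifford sq pol (v # xs) u f (insert 0 (Suc ` J)) =
    (if u = v then f (Suc ` J) else - clifford sq pol xs u (\<lambda>J. f (insert 0 (Suc ` J))) J)"
  by (simp_all add: Let_def vimage_Suc_insert image_iff)

text \<open>The case split that matches the recursion of \<open>clifford\<close>: position
  \<open>0\<close> belongs to the head letter, and the other positions are shifted.\<close>

lemma nat_set_cases:
  obtains (Suc) J where "I = Suc ` J" | (zero) J where "I = insert 0 (Suc ` J)"
proof (cases "0 \<in> I")
  case True
  then have "n \<in> I \<longleftrightarrow> n \<in> insert 0 (Suc ` (Suc -` I))" for n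
    by (cases n) auto
  then have "I = insert 0 (Suc ` (Suc -` I))"
    by blast
  then show ?thesis
    by (rule zero)
next
  case False
  then have "n \<in> I \<longleftrightarrow> n \<in> Suc ` (Suc -` I)" for n
    by (cases n) auto
  then have "I = Suc ` (Suc -` I)"
    by blast
  then show ?thesis
    by (rule Suc)
qed

declare clifford.simps(2) [simp del]

lemma clifford_linear:
  "clifford sq pol xs u (\<lambda>I. f I + p * g I) I = clifford sq pol xs u f I + p * clifford sq pol xs u g I"
proof (induction xs arbitrary: f g I)
  case (Cons v xs)
  show ?case
    by (cases I rule: nat_set_cases) (simp_all add: clifford_Suc Cons.IH algebra_simps)
qed simp

lemma clifford_uminus: "clifford sq pol xs u (\<lambda>I. - g I) I = - clifford sq pol xs u g I"
  \<comment> \<open>The second instance reads z = z - z for the image z of the zero vector, so z =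
    0.\<close>
  using clifford_linear[of sq pol xs u "\<lambda>I. 0" "-1" g I]
    clifford_linear[of sq pol xs u "\<lambda>I. 0" "-1" "\<lambda>I. 0" I] by simp

lemma clifford_smult: "clifford sq pol xs u (\<lambda>I. p * g I) I = p * clifford sq pol xs u g I"
  using clifford_linear[of sq pol xs u "\<lambda>I. 0" p g I]
    clifford_linear[of sq pol xs u "\<lambda>I. 0" "-1" "\<lambda>I. 0" I] by simp

lemma clifford_square:
  assumes "distinct xs" "u \<in> set xs"
  shows "clifford sq pol xs u (clifford sq pol xs u f) I = sq u * f I"
  using assms
proof (induction xs arbitrary: f I)
  case (Cons v xs)
  note linear = clifford_linear clifford_uminus clifford_smult
  have IH: "clifford sq pol xs u (clifford sq pol xs u f) I = sq u * f I" if "u \<noteq> v" for f I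
    using Cons.IH[of f I] Cons.prems that by simp
  show ?case
    by (cases I rule: nat_set_cases; cases "u = v")
      (simp_all add: clifford_Suc linear IH)
qed simp

text \<open>If one of the letters is the head v, the summand with \<open>pol\<close> together with
  the minus sign in the v-component gives the relation. If neither is, write the vector as a + v b:
  the mixed terms {w, v} u b and {u, v} w b occur with opposite signs in the two orders and cancel,
  and the rest is the induction hypothesis for a and b.\<close>

lemma clifford_anticommute:
  assumes "distinct xs" "u \<in> set xs" "w \<in> set xs" "u \<noteq> w" "\<And>u v. pol u v = pol v u"
  shows "clifford sq pol xs u (clifford sq pol xs w f) I =
    pol u w * f I - clifford sq pol xs w (clifford sq pol xs u f) I"
  using assms(1-3)
proof (induction xs arbitrary: f I)
  case (Cons v xs)
  note linear = clifford_linear clifford_uminus clifford_smult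
  have IH: "clifford sq pol xs u (clifford sq pol xs w f) I =
      pol u w * f I - clifford sq pol xs w (clifford sq pol xs u f) I"
    if "u \<noteq> v" "w \<noteq> v" for f I
    using Cons.IH[of f I] Cons.prems that by simp
  show ?case
    using assms(4)
    by (cases I rule: nat_set_cases; cases "u = v"; cases "w = v")
      (simp add: clifford_Suc linear IH assms(5)[of v w]; simp add: algebra_simps)+
qed simp

lemma clifford_relation:
  assumes "distinct xs" "u \<in> set xs" "w \<in> set xs" "\<And>u v. pol u v = pol v u"
  shows "clifford sq pol xs u (clifford sq pol xs w f) I + clifford sq pol xs w (clifford sq pol xs u f) I =
    (if u = w then 2 * sq u else pol u w) * f I"
  using assms clifford_square[of xs u sq pol f I] clifford_anticommute[of xs u w pol sq f I] by auto

text \<open>The coordinate vectors of the module; \<open>unit_at {}\<close> is the vacuum.\<close>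

definition unit_at :: "nat set \<Rightarrow> nat set \<Rightarrow> 'p::comm_ring_1" where
  "unit_at I J = (if I = J then 1 else 0)"

lemma Suc_image_eq: "Suc ` I = Suc ` J \<longleftrightarrow> I = J" "insert 0 (Suc ` I) = insert 0 (Suc ` J) \<longleftrightarrow> I = J"
  "insert 0 (Suc ` I) \<noteq> Suc ` J" "Suc ` I \<noteq> insert 0 (Suc ` J)"
  by (metis vimage_Suc_insert)+ auto

lemma unit_at_Suc:
  "unit_at (Suc ` I) (Suc ` J) = unit_at I J"
  "unit_at (insert 0 (Suc ` I)) (insert 0 (Suc ` J)) = unit_at I J"
  "unit_at (insert 0 (Suc ` I)) (Suc ` J) = 0"
  "unit_at (Suc ` I) (insert 0 (Suc ` J)) = 0"
  unfolding unit_at_def by (simp_all add: Suc_image_eq)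

lemma nths_Cons_Suc: "nths (v # xs) (Suc ` J) = nths xs J"
  "nths (v # xs) (insert 0 (Suc ` J)) = v # nths xs J"
  by (simp_all add: nths_Cons image_iff)

text \<open>Vectors without a \<open>v\<close>-component form a copy of the smaller module, and
  letters other than \<open>v\<close> preserve it and act on it as they do there.\<close>

lemma foldr_clifford_Cons:
  assumes "v \<notin> set us" "\<And>J. f (insert 0 (Suc ` J)) = 0"
  shows "foldr (clifford sq pol (v # xs)) us f (insert 0 (Suc ` J)) = 0"
    "foldr (clifford sq pol (v # xs)) us f (Suc ` J) =
      foldr (clifford sq pol xs) us (\<lambda>J. f (Suc ` J)) J"
  using assms
proof (induction us arbitrary: J)
  case (Cons u us)
  have 0: "clifford sq pol xs u (\<lambda>J. 0) J = 0" for J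
    using clifford_smult[of sq pol xs u 0 "\<lambda>J. 0"] by simp
  case 1
  then show ?case
    using Cons by (auto simp: clifford_Suc 0)
  case 2
  then show ?case
    using Cons by (auto simp: clifford_Suc 0)
qed auto

text \<open>Since \<open>foldr\<close> applies the rightmost letter first and \<open>nths\<close>
  lists positions in increasing order, each letter acts after all letters at later positions. It
  then meets a vector without its own component and only adjoins its position, so no lower terms
  arise.\<close>

lemma foldr_clifford_unit:
  fixes sq :: "'v \<Rightarrow> 'p::comm_ring_1"
  assumes "distinct xs" "I \<subseteq> {..<length xs}"
  shows "foldr (clifford sq pol xs) (nths xs I) (unit_at {}) J = unit_at I J"
  using assms
proof (induction xs arbitrary: I J)
  case (Cons v xs)
  let ?f = "unit_at {} :: nat set \<Rightarrow> 'p"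
  have f0: "?f (insert 0 (Suc ` J)) = 0" for J
    by (simp add: unit_at_def)
  have f1: "?f (Suc ` J) = unit_at {} J" for J
    by (simp add: unit_at_def)
  have v: "v \<notin> set (nths xs I')" for I'
    using Cons.prems(1) set_nths_subset[of xs I'] by auto
  note simps = foldr_clifford_Cons[where f = ?f, OF v f0] f1 nths_Cons_Suc clifford_Suc unit_at_Suc
  have J: "J \<subseteq> {..<length xs}" if "Suc ` J \<subseteq> {..<length (v # xs)}" for J
    using that by auto
  show ?case
    using Cons.prems
    by (cases I rule: nat_set_cases; cases J rule: nat_set_cases)
      (simp_all add: simps Cons.IH[OF _ J])
qed simp

text \<open>A letter raises the size of an index set by at most one. The bound is an integer because
  the component at the head letter is treated with \<open>k - 1\<close>, which is negative for
  \<open>k = 0\<close>.\<close>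

lemma clifford_degree:
  fixes k :: int
  assumes "\<And>I. finite I \<Longrightarrow> int (card I) \<ge> k \<Longrightarrow> f I = 0" "finite I" "int (card I) \<ge> k + 1"
  shows "clifford sq pol xs u f I = 0"
  using assms
proof (induction xs arbitrary: f I k)
  case (Cons v xs)
  have card: "finite J \<Longrightarrow> card (insert 0 (Suc ` J)) = Suc (card J)" "card (Suc ` J) = card J" for J
    by (simp_all add: card_image)
  have fin: "finite (Suc ` J) \<longleftrightarrow> finite J" for J
    by (simp add: finite_image_iff)
  show ?case
  proof (cases I rule: nat_set_cases)
    case (Suc J)
    then have J: "finite J" "int (card J) \<ge> k + 1"
      using Cons.prems by (simp_all add: card fin)
    have "clifford sq pol xs u (\<lambda>J. f (Suc ` J)) J = 0"
      using J by (intro Cons.IH[of k]) (auto intro!: Cons.prems(1) simp: card fin)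
    moreover have "f (insert 0 (Suc ` J)) = 0"
      using J by (intro Cons.prems(1)) (simp_all add: card)
    ultimately show ?thesis
      by (simp add: Suc clifford_Suc)
  next
    case (zero J)
    then have J: "finite J" "int (card J) \<ge> k"
      using Cons.prems by (simp_all add: card fin)
    have "clifford sq pol xs u (\<lambda>J. f (insert 0 (Suc ` J))) J = 0"
      using J by (intro Cons.IH[of "k - 1"]) (auto intro!: Cons.prems(1) simp: card fin)
    moreover have "f (Suc ` J) = 0"
      using J by (intro Cons.prems(1)) (simp_all add: card)
    ultimately show ?thesis
      by (simp add: zero clifford_Suc)
  qed
qed simp

lemma foldr_clifford_degree:
  assumes "finite I" "card I > length us"
  shows "foldr (clifford sq pol xs) us (unit_at {}) I = 0"
proof -
  have "finite I \<Longrightarrow> int (card I) \<ge> int (length us) + 1 \<Longrightarrow>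
      foldr (clifford sq pol xs) us (unit_at {}) I = 0"
  proof (induction us arbitrary: I)
    case Nil
    then show ?case
      by (auto simp: unit_at_def)
  next
    case (Cons u us)
    show ?case
      unfolding foldr.simps o_apply
      by (rule clifford_degree[of "int (length us) + 1"]) (use Cons in auto)
  qed
  then show ?thesis
    using assms by simp
qed


section \<open>Modules over the radial algebra\<close>

text \<open>Linearity over the polynomials makes the radial relations act by zero: the
  anticommutator of two letters is multiplication by a polynomial and so commutes with every letter.
  All variables of the type need an operator, because the quotient is formed over all of
  them.\<close>

locale radial_module =
  fixes L :: "'v \<Rightarrow> (nat set \<Rightarrow> 'g mpoly) \<Rightarrow> nat set \<Rightarrow> 'g mpoly"
    and C :: "'v \<Rightarrow> 'v \<Rightarrow> 'g mpoly"
  assumes linear: "L u (\<lambda>I. f I + p * g I) = (\<lambda>I. L u f I + p * L u g I)"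
    and relation: "L u (L v f) I + L v (L u f) I = C u v * f I"
begin

lemma zero: "L u (\<lambda>I. 0) = (\<lambda>I. 0)"
  using linear[of u "\<lambda>I. 0" "-1" "\<lambda>I. 0"] by simp

lemma smult: "L u (\<lambda>I. p * f I) = (\<lambda>I. p * L u f I)"
  using linear[of u "\<lambda>I. 0" p f] by (simp add: zero)

lemma foldr_linear:
  "foldr L us (\<lambda>I. f I + p * g I) = (\<lambda>I. foldr L us f I + p * foldr L us g I)"
  by (induction us) (simp_all add: linear)

definition free_act ::
  "('v fword \<Rightarrow>\<^sub>0 coeff) \<Rightarrow> (nat set \<Rightarrow> 'g mpoly) \<Rightarrow> nat set \<Rightarrow> 'g mpoly" where
  "free_act f m I =
    (\<Sum>w \<in> Poly_Mapping.keys f. mconst (Poly_Mapping.lookup f w) * foldr L (letters w) m I)"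

lemma free_act_linear:
  "free_act f (\<lambda>I. m I + p * m' I) = (\<lambda>I. free_act f m I + p * free_act f m' I)"
  by (rule ext)
    (simp add: free_act_def foldr_linear sum.distrib sum_distrib_left distrib_left mult.left_commute)

lemma free_act_zero: "free_act f (\<lambda>I. 0) = (\<lambda>I. 0)"
  using free_act_linear[of f "\<lambda>I. 0" "-1" "\<lambda>I. 0"] by simp

lemma free_act_add: "free_act (f + g) m I = free_act f m I + free_act g m I"
proof -
  have superset: "free_act h m I =
      (\<Sum>w \<in> A. mconst (Poly_Mapping.lookup h w) * foldr L (letters w) m I)"
    if "finite A" "Poly_Mapping.keys h \<subseteq> A" for h A
    unfolding free_act_def using that
    by (intro sum.mono_neutral_left) (auto simp: in_keys_iff)
  show ?thesis
    by (subst (1 2 3) superset[of "Poly_Mapping.keys f \<union> Poly_Mapping.keys g"])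
      (auto simp: lookup_add single_add distrib_right sum.distrib dest: keys_add[THEN subsetD])
qed

lemma free_act_single: "free_act (Poly_Mapping.single w c) m I = mconst c * foldr L (letters w) m I"
  by (simp add: free_act_def)

lemma free_act_gen: "free_act (free_gen u) m = L u m"
  by (rule ext) (simp add: free_gen_def free_act_single)

lemma free_act_sum: "free_act (sum h A) m I = (\<Sum>i \<in> A. free_act (h i) m I)"
  by (induction A rule: infinite_finite_induct) (simp_all add: free_act_add, simp_all add: free_act_def)

lemma free_act_sum_right:
  "free_act f (\<lambda>I. \<Sum>i \<in> A. h i I) I = (\<Sum>i \<in> A. free_act f (h i) I)"
proof (induction A rule: infinite_finite_induct)
  case (insert i A)
  then show ?case
    using free_act_linear[of f "h i" 1 "\<lambda>I. \<Sum>i \<in> A. h i I"] by simp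
qed (simp_all add: free_act_zero)

lemma free_act_mult: "free_act (f * g) m = free_act f (free_act g m)"
proof
  fix I
  let ?s = "\<lambda>f w. Poly_Mapping.single w (Poly_Mapping.lookup f w)"
  have smult: "free_act f (\<lambda>I. p * m I) I = p * free_act f m I" for f p m I
    using free_act_linear[of f "\<lambda>I. 0" p m] by (simp add: free_act_zero)
  have single: "free_act (Poly_Mapping.single w c * Poly_Mapping.single w' c') m I =
      free_act (Poly_Mapping.single w c) (free_act (Poly_Mapping.single w' c') m) I" for w c w' c'
  proof -
    have "free_act (Poly_Mapping.single w' c') m = (\<lambda>I. mconst c' * foldr L (letters w') m I)"
      by (rule ext) (rule free_act_single)
    then have "free_act (Poly_Mapping.single w c) (free_act (Poly_Mapping.single w' c') m) I =
        mconst c' * (mconst c * foldr L (letters w) (foldr L (letters w') m) I)"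
      by (simp add: smult free_act_single)
    moreover have "mconst c' * mconst c = (mconst (c * c') :: 'g mpoly)"
      by (simp add: mult_single mult.commute)
    ultimately show ?thesis
      by (simp add: mult_single free_act_single flip: mult.assoc)
  qed
  have g: "(\<lambda>I. \<Sum>w \<in> Poly_Mapping.keys g. free_act (?s g w) m I) = free_act g m"
    by (rule ext) (simp only: poly_mapping_sum_single flip: free_act_sum)
  have "free_act ((\<Sum>w \<in> Poly_Mapping.keys f. ?s f w) * (\<Sum>w \<in> Poly_Mapping.keys g. ?s g w)) m I =
      (\<Sum>w \<in> Poly_Mapping.keys f. \<Sum>w' \<in> Poly_Mapping.keys g.
        free_act (?s f w) (free_act (?s g w') m) I)"
    by (simp only: sum_product free_act_sum single)
  also have "\<dots> = free_act (\<Sum>w \<in> Poly_Mapping.keys f. ?s f w) (free_act g m) I"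
    by (simp only: g free_act_sum flip: free_act_sum_right)
  finally show "free_act (f * g) m I = free_act f (free_act g m) I"
    by (simp only: poly_mapping_sum_single)
qed

lemma free_act_diff: "free_act (f - g) m I = free_act f m I - free_act g m I"
  using free_act_add[of "f - g" g m I] by simp

lemma free_act_ideal: "f \<in> radial_ideal UNIV \<Longrightarrow> free_act f m = (\<lambda>I. 0)"
proof (induction arbitrary: m rule: radial_ideal.induct)
  case zero
  show ?case
    by (rule ext) (simp add: free_act_def)
next
  case (rel u v w)
  have *: "free_act (anticomm (free_gen u) (free_gen v)) m = (\<lambda>I. C u v * m I)" for m
    by (rule ext) (simp add: anticomm_def free_act_add free_act_mult free_act_gen relation)
  show ?case
    by (rule ext) (simp add: comm_def free_act_diff free_act_mult * free_act_gen smult)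
next
  case (add f g)
  then show ?case
    by (intro ext) (simp add: free_act_add)
qed (simp_all add: free_act_mult free_act_zero)

text \<open>The choice of representative is harmless, because the ideal of relations acts by
  zero.\<close>

definition act :: "(coeff, 'v) radial \<Rightarrow> (nat set \<Rightarrow> 'g mpoly) \<Rightarrow> nat set \<Rightarrow> 'g mpoly" where
  "act a = free_act (rep_radial a)"

lemma act_abs: "act (abs_radial f) = free_act f"
proof (intro ext)
  fix m I
  have "radial_eq (rep_radial (abs_radial f)) f"
    by (metis radial.abs_eq_iff Quotient_radial Quotient_abs_rep)
  then have "free_act (rep_radial (abs_radial f) - f) m I = 0"
    by (simp add: radial_eq_def free_act_ideal)
  then show "act (abs_radial f) m I = free_act f m I"
    by (simp add: act_def free_act_diff)
qed

lemma act_add: "act (a + b) m I = act a m I + act b m I"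
  by (induction a; induction b) (simp add: plus_radial.abs_eq act_abs free_act_add)

lemma act_mult: "act (a * b) m = act a (act b m)"
  by (induction a; induction b) (simp add: times_radial.abs_eq act_abs free_act_mult)

lemma act_scal: "act (scal c) m I = mconst c * m I"
  by (simp add: scal.abs_eq act_abs free_act_single)

lemma act_gen: "act (gen u) m = L u m"
  by (simp add: gen.abs_eq act_abs free_act_gen)

lemma act_linear: "act a (\<lambda>I. m I + p * m' I) = (\<lambda>I. act a m I + p * act a m' I)"
  by (simp add: act_def free_act_linear)

lemma act_smult: "act a (\<lambda>I. p * m I) I = p * act a m I"
  using act_linear[of a "\<lambda>I. 0" p m] by (simp add: act_def free_act_zero)

lemma act_zero: "act 0 m I = 0"
  using act_add[of 0 0 m I] by simp

lemma act_sum: "act (\<Sum>i \<in> A. h i) m I = (\<Sum>i \<in> A. act (h i) m I)"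
  by (induction A rule: infinite_finite_induct) (simp_all add: act_zero act_add)

lemma act_anticomm: "act (anticomm (gen u) (gen v)) m I = C u v * m I"
  by (simp add: anticomm_def act_add act_mult act_gen relation)

lemma act_prod_list: "act (prod_list (map gen us)) m = foldr L us m"
proof (induction us arbitrary: m)
  case Nil
  show ?case
    using act_scal[of 1 m] by auto
qed (simp add: act_mult act_gen)

end

section \<open>The module attached to a list of variables, and the symbols of scalars\<close>

locale radial_frame =
  fixes x :: 'v and ys :: "'v list"
  assumes distinct: "distinct (x # ys)"
begin

abbreviation "\<A> \<equiv> scalars x (set ys)"

abbreviation "V \<equiv> (radial_on (insert x (set ys)) :: (coeff, 'v) radial set)"

text \<open>The square of x is the variable r itself, whereas for y in Y the variable is c_yy = {y,
  y} = 2 y^2; hence the factor 1/2.\<close>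

definition sq :: "'v \<Rightarrow> (coeff, 'v) radial mpoly" where
  "sq u = (if u = x then mvar ((gen u)\<^sup>2)
    else mconst (of_real (1 / 2)) * mvar (anticomm (gen u) (gen u)))"

definition pol :: "'v \<Rightarrow> 'v \<Rightarrow> (coeff, 'v) radial mpoly" where
  "pol u v = mvar (anticomm (gen u) (gen v))"

text \<open>Variables outside the frame act by zero. This respects the radial relations, and it
  separates the frame's scalar generators from anticommutators with foreign variables.\<close>

definition letter ::
  "'v \<Rightarrow> (nat set \<Rightarrow> (coeff, 'v) radial mpoly) \<Rightarrow> nat set \<Rightarrow> (coeff, 'v) radial mpoly" where
  "letter u = (if u \<in> set (x # ys) then clifford sq pol (x # ys) u else (\<lambda>_ _. 0))"

sublocale radial_module letter
  "\<lambda>u v. if u \<in> set (x # ys) \<and> v \<in> set (x # ys) then if u = v then 2 * sq u else pol u v else 0"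
proof
  show "letter u (\<lambda>I. f I + p * g I) = (\<lambda>I. letter u f I + p * letter u g I)" for u f p g
    by (rule ext) (simp add: letter_def clifford_linear)
  have zero: "clifford sq pol (x # ys) u (\<lambda>I. 0) I = 0" for u I
    using clifford_smult[of sq pol "x # ys" u 0 "\<lambda>I. 0" I] by simp
  show "letter u (letter v f) I + letter v (letter u f) I =
      (if u \<in> set (x # ys) \<and> v \<in> set (x # ys) then if u = v then 2 * sq u else pol u v else 0) * f I"
    for u v f I
    using clifford_relation[OF distinct, of u v pol sq f I]
    by (auto simp: letter_def zero pol_def anticomm_commute[of "gen u" "gen v" for u v])
qed

lemma act_scalar_gen:
  assumes "g \<in> scalar_gens x (set ys)"
  shows "act g m I = mvar g * m I"
proof -
  \<comment> \<open>Needed for the generators c_yy, where the relation gives \<open>2 * sq y\<close>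
    and \<open>sq y\<close> is half a variable.\<close>
  have half: "2 * (mconst (of_real (1 / 2)) * p) = p" for p :: "(coeff, 'v) radial mpoly"
  proof -
    have "2 * mconst (of_real (1 / 2)) = (mconst (of_real (1 / 2) + of_real (1 / 2)) :: (coeff, 'v) radial mpoly)"
      by (simp only: mult_2 single_add)
    also have "\<dots> = 1"
      by (simp flip: of_real_add)
    finally show ?thesis
      by (simp flip: mult.assoc)
  qed
  consider "g = (gen x)\<^sup>2" | y where "y \<in> set ys" "g = anticomm (gen x) (gen y)"
    | y z where "y \<in> set ys" "z \<in> set ys" "g = anticomm (gen y) (gen z)"
    using assms unfolding scalar_gens_def by blast
  then show ?thesis
  proof cases
    case 1
    show ?thesis
      unfolding 1 power2_eq_square act_mult act_gen using clifford_square[OF distinct, of x sq pol]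
      by (simp add: letter_def sq_def power2_eq_square)
  next
    case 2
    then show ?thesis
      using distinct by (auto simp: act_anticomm pol_def)
  next
    case 3
    then show ?thesis
      using distinct by (auto simp: act_anticomm pol_def sq_def half)
  qed
qed

definition symbol :: "(coeff, 'v) radial \<Rightarrow> (coeff, 'v) radial mpoly" where
  "symbol a = act a (unit_at {}) {}"

lemma scalar_symbol:
  assumes "a \<in> \<A>"
  shows act_scalar: "act a m I = symbol a * m I"
    and eval_symbol: "eval_poly (\<lambda>g. g) (symbol a) = a"
proof -
  \<comment> \<open>Both claims are proved for some common polynomial first: only once scalars act
    by multiplication can the polynomial be read off from the vacuum, and this identifies it with
    \<open>symbol a\<close>.\<close>
  have "\<exists>p. (\<forall>m I. act a m I = p * m I) \<and> eval_poly (\<lambda>g. g) p = a"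
    using assms
  proof induction
    case (scal c)
    show ?case
      by (intro exI[of _ "mconst c"]) (simp add: act_scal eval_poly_mconst)
  next
    case (gen g)
    then show ?case
      by (intro exI[of _ "mvar g"]) (simp add: act_scalar_gen eval_poly_mvar central_scalar_gens)
  next
    case (add a b)
    then obtain p p' where "\<forall>m I. act a m I = p * m I" "eval_poly (\<lambda>g. g) p = a"
      "\<forall>m I. act b m I = p' * m I" "eval_poly (\<lambda>g. g) p' = b"
      by blast
    then show ?case
      by (intro exI[of _ "p + p'"]) (simp add: act_add eval_poly_add distrib_right)
  next
    case (mult a b)
    then obtain p p' where "\<forall>m I. act a m I = p * m I" "eval_poly (\<lambda>g. g) p = a"
      "\<forall>m I. act b m I = p' * m I" "eval_poly (\<lambda>g. g) p' = b"
      by blast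
    then show ?case
      by (intro exI[of _ "p * p'"]) (simp add: act_mult eval_poly_mult mult.assoc)
  qed
  then obtain p where p: "\<And>m I. act a m I = p * m I" "eval_poly (\<lambda>g. g) p = a"
    by blast
  then have "symbol a = p"
    by (simp add: symbol_def unit_at_def)
  then show "act a m I = symbol a * m I" "eval_poly (\<lambda>g. g) (symbol a) = a"
    using p by simp_all
qed

lemma symbol_hom:
  assumes "a \<in> \<A>" "b \<in> \<A>"
  shows "symbol (a + b) = symbol a + symbol b" "symbol (a * b) = symbol a * symbol b"
  using assms
  by (simp_all add: symbol_def[of "a + b"] symbol_def[of "a * b"] act_add act_mult act_scalar unit_at_def)

lemma symbol_scal: "symbol (scal c) = mconst c"
  by (simp add: symbol_def act_scal unit_at_def)

lemma symbol_gen: "g \<in> scalar_gens x (set ys) \<Longrightarrow> symbol g = mvar g"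
  by (simp add: symbol_def act_scalar_gen unit_at_def)

lemma symbol_eq_0: "a \<in> \<A> \<Longrightarrow> symbol a = 0 \<Longrightarrow> a = 0"
  using eval_symbol[of a] by (simp add: eval_poly_def)

text \<open>On symbols, multiplication by \<open>scal c * u\<close> is multiplication by a single
  non-zero monomial, and \<open>symbol\<close> is injective on the scalars.\<close>

lemma scalar_cancel:
  assumes "u \<in> scalar_gens x (set ys)" "a \<in> \<A>" "c \<noteq> 0" "scal c * u * a = 0"
  shows "a = 0"
proof -
  have u: "u \<in> \<A>"
    using assms(1) by (rule subalg.gen)
  have "symbol (scal c * u * a) = Poly_Mapping.single {#u#} c * symbol a"
    using assms(1,2) u
    by (simp add: symbol_hom symbol_scal symbol_gen subalg.scal subalg.mult mult_single)
  moreover have "symbol 0 = 0"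
    by (simp add: symbol_def act_zero)
  ultimately have "Poly_Mapping.single {#u#} c * symbol a = 0"
    using assms(4) by simp
  then have "symbol a = 0"
    using assms(3) by (rule single_mult_eq_0)
  then show ?thesis
    by (rule symbol_eq_0[OF assms(2)])
qed

text \<open>The foreign variable \<open>z\<close> acts by zero, so this anticommutator has symbol
  \<open>0\<close>, while the symbol of a generator is its own variable.\<close>

lemma anticomm_notin_scalar_gens:
  assumes "z \<notin> set (x # ys)"
  shows "anticomm (gen x) (gen z) \<notin> scalar_gens x (set ys)"
proof
  let ?s = "anticomm (gen x) (gen z) :: (coeff, 'v) radial"
  assume *: "?s \<in> scalar_gens x (set ys)"
  have "symbol ?s = 0"
    using assms by (simp add: symbol_def act_anticomm)
  then show False
    using symbol_gen[OF *] by (simp add: poly_mapping_eq_iff fun_eq_iff)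
      (metis lookup_single_eq lookup_zero zero_neq_one)
qed


section \<open>Dilations and Jackson operators\<close>

definition is_dilation ::
  "(coeff, 'v) radial \<Rightarrow> coeff \<Rightarrow> ((coeff, 'v) radial \<Rightarrow> (coeff, 'v) radial) \<Rightarrow> bool"
where
  "is_dilation u P T \<longleftrightarrow> T \<in> \<A> \<rightarrow>\<^sub>E \<A> \<and> (\<forall>c. T (scal c) = scal c) \<and>
    (\<forall>f\<in>\<A>. \<forall>g\<in>\<A>. T (f + g) = T f + T g \<and> T (f * g) = T f * T g) \<and>
    T u = scal P * u \<and> (\<forall>g\<in>scalar_gens x (set ys) - {u}. T g = g)"

lemma is_dilation_unique:
  assumes "is_dilation u P T" "is_dilation u P T'"
  shows "T = T'"
proof (rule PiE_ext[of T \<A> "\<lambda>_. \<A>"])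
  show "T f = T' f" if "f \<in> \<A>" for f
    using that
  proof induction
    case (gen g)
    then show ?case
      using assms unfolding is_dilation_def by (cases "g = u") auto
  qed (use assms in \<open>simp_all add: is_dilation_def\<close>)
qed (use assms in \<open>simp_all add: is_dilation_def\<close>)

text \<open>The dilation is a substitution performed on symbols: evaluating at
  \<open>scal P * u\<close> in place of \<open>u\<close> is a homomorphism because the new value is
  again central. Uniqueness then makes it the one selected by the definite description.\<close>

lemma is_dilation_dilation:
  assumes u: "u \<in> scalar_gens x (set ys)"
  shows "is_dilation u P (dilation (scalar_gens x (set ys)) u P)"
proof -
  define h where "h g = (if g = u then scal P * u else g)" for g :: "(coeff, 'v) radial"
  define T where "T = (\<lambda>f \<in> \<A>. eval_poly h (symbol f))"
  have h: "h g \<in> \<A>" "central (h g)" if "g \<in> scalar_gens x (set ys)" for g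
    using that u
    by (auto simp: h_def subalg.intros central_mult central_scal central_scalar_gens)
  have T_scal: "T (scal c) = scal c" for c
    by (simp add: T_def subalg.scal symbol_scal eval_poly_mconst)
  have T_gen: "T g = h g" if "g \<in> scalar_gens x (set ys)" for g
    using that by (simp add: T_def subalg.gen symbol_gen eval_poly_mvar h)
  have T_hom: "T (f + g) = T f + T g" "T (f * g) = T f * T g" if "f \<in> \<A>" "g \<in> \<A>" for f g
    using that by (simp_all add: T_def subalg.add subalg.mult symbol_hom eval_poly_add eval_poly_mult)
  have T_in: "T f \<in> \<A>" if "f \<in> \<A>" for f
    using that by induction (simp_all add: T_scal T_gen h T_hom subalg.intros)
  have "is_dilation u P T"
    unfolding is_dilation_def using u T_in
    by (auto simp: T_scal T_hom T_gen h_def) (simp_all add: T_def)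
  then have "\<exists>!T. is_dilation u P T"
    using is_dilation_unique by blast
  then have "is_dilation u P (THE T. is_dilation u P T)"
    by (rule theI')
  then show ?thesis
    unfolding dilation_def is_dilation_def .
qed

lemmas dilation_spec = is_dilation_dilation[unfolded is_dilation_def]

lemma
  assumes "u \<in> scalar_gens x (set ys)"
  shows dilation_in: "f \<in> \<A> \<Longrightarrow> dilation (scalar_gens x (set ys)) u P f \<in> \<A>"
    and dilation_scal: "dilation (scalar_gens x (set ys)) u P (scal c) = scal c"
    and dilation_add: "f \<in> \<A> \<Longrightarrow> g \<in> \<A> \<Longrightarrow> dilation (scalar_gens x (set ys)) u P (f + g) =
      dilation (scalar_gens x (set ys)) u P f + dilation (scalar_gens x (set ys)) u P g"
    and dilation_mult: "f \<in> \<A> \<Longrightarrow> g \<in> \<A> \<Longrightarrow> dilation (scalar_gens x (set ys)) u P (f * g) =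
      dilation (scalar_gens x (set ys)) u P f * dilation (scalar_gens x (set ys)) u P g"
    and dilation_gen: "g \<in> scalar_gens x (set ys) \<Longrightarrow>
      dilation (scalar_gens x (set ys)) u P g = (if g = u then scal P * u else g)"
  using dilation_spec[OF assms, of P] by (auto simp: PiE_iff)

text \<open>With T the dilation, divisibility of f - T f by (1 - P) u passes to products by the
  twisted Leibniz rule f g - T f T g = (f - T f) g + T f (g - T g).\<close>

lemma jackson_exists:
  assumes u: "u \<in> scalar_gens x (set ys)" and f: "f \<in> \<A>"
  shows "\<exists>g\<in>\<A>. scal (1 - P) * u * g = f - dilation (scalar_gens x (set ys)) u P f"
  using f
proof induction
  case (scal c)
  show ?case
    using u by (intro bexI[of _ 0]) (simp_all add: dilation_scal subalg_0)
next
  case (gen g)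
  have "scal (1 - P) * u = u - scal P * u"
    using scal_add[of "1 - P" P] by (metis add_diff_cancel_right' diff_add_cancel left_diff_distrib mult_1 scal_1)
  then show ?case
    using u gen by (intro bexI[of _ "if g = u then 1 else 0"]) (auto simp: dilation_gen subalg_0 subalg_1)
next
  case (add f g)
  then obtain f' g' where "f' \<in> \<A>" "g' \<in> \<A>"
    "scal (1 - P) * u * f' = f - dilation (scalar_gens x (set ys)) u P f"
    "scal (1 - P) * u * g' = g - dilation (scalar_gens x (set ys)) u P g"
    by blast
  then show ?case
    using u add by (intro bexI[of _ "f' + g'"]) (simp_all add: dilation_add distrib_left subalg.add)
next
  case (mult f g)
  let ?T = "dilation (scalar_gens x (set ys)) u P"
  obtain f' g' where *: "f' \<in> \<A>" "g' \<in> \<A>"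
    "scal (1 - P) * u * f' = f - ?T f" "scal (1 - P) * u * g' = g - ?T g"
    using mult by blast
  have T: "?T f \<in> \<A>"
    using u mult by (intro dilation_in)
  have "central (scal (1 - P) * u)"
    using u by (intro central_mult central_scal central_scalar_gens)
  then have "scal (1 - P) * u * (f' * g + ?T f * g') =
      (scal (1 - P) * u * f') * g + ?T f * (scal (1 - P) * u * g')"
    by (simp add: distrib_left central_left_commute[of "scal (1 - P) * u" "?T f"] mult.assoc[of _ f'])
  also have "\<dots> = f * g - ?T f * ?T g"
    by (simp only: *) (simp add: algebra_simps)
  finally show ?case
    using u mult * T by (intro bexI[of _ "f' * g + ?T f * g'"])
      (simp_all add: dilation_mult subalg.add subalg.mult)
qed

lemma jackson_eqI:
  assumes u: "u \<in> scalar_gens x (set ys)" and P: "P \<noteq> 1" and f: "f \<in> \<A>" and g: "g \<in> \<A>"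
    and eq: "scal (1 - P) * u * g = f - dilation (scalar_gens x (set ys)) u P f"
  shows "jackson (scalar_gens x (set ys)) u P f = g"
  unfolding jackson_def
proof (rule the_equality)
  fix g'
  assume g': "g' \<in> \<A> \<and> scal (1 - P) * u * g' = f - dilation (scalar_gens x (set ys)) u P f"
  then have "scal (1 - P) * u * (g' - g) = 0"
    using eq by (simp add: right_diff_distrib)
  moreover have "g' - g \<in> \<A>" "1 - P \<noteq> 0"
    using P g g' by (simp_all add: subalg_diff)
  ultimately have "g' - g = 0"
    using scalar_cancel[OF u] by blast
  then show "g' = g"
    by simp
qed (use g eq in blast)

lemma jackson_spec:
  assumes "u \<in> scalar_gens x (set ys)" "P \<noteq> 1" "f \<in> \<A>"
  shows "jackson (scalar_gens x (set ys)) u P f \<in> \<A>"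
    "scal (1 - P) * u * jackson (scalar_gens x (set ys)) u P f =
      f - dilation (scalar_gens x (set ys)) u P f"
  using jackson_exists[OF assms(1,3), of P] jackson_eqI[OF assms(1-3)] by auto

lemma jackson_add:
  assumes "u \<in> scalar_gens x (set ys)" "P \<noteq> 1" "f \<in> \<A>" "g \<in> \<A>"
  shows "jackson (scalar_gens x (set ys)) u P (f + g) =
    jackson (scalar_gens x (set ys)) u P f + jackson (scalar_gens x (set ys)) u P g"
  by (rule jackson_eqI)
    (use assms in \<open>simp_all add: jackson_spec distrib_left dilation_add subalg.add\<close>)

lemma jackson_scal_mult:
  assumes "u \<in> scalar_gens x (set ys)" "P \<noteq> 1" "f \<in> \<A>"
  shows "jackson (scalar_gens x (set ys)) u P (scal c * f) =
    scal c * jackson (scalar_gens x (set ys)) u P f"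
proof (rule jackson_eqI)
  show "scal (1 - P) * u * (scal c * jackson (scalar_gens x (set ys)) u P f) =
      scal c * f - dilation (scalar_gens x (set ys)) u P (scal c * f)"
    using assms
    by (simp add: central_left_commute[OF central_scal, of c "scal (1 - P) * u", symmetric]
        jackson_spec dilation_mult dilation_scal subalg.scal right_diff_distrib)
qed (use assms in \<open>simp_all add: jackson_spec subalg.scal subalg.mult\<close>)

lemma square_in_scalar_gens: "(gen x)\<^sup>2 \<in> scalar_gens x (set ys)"
  and anticomm_in_scalar_gens: "y \<in> set ys \<Longrightarrow> anticomm (gen x) (gen y) \<in> scalar_gens x (set ys)"
  by (auto simp: scalar_gens_def)

text \<open>The two Jackson parameters q and q^2 must differ from 1 for the factor 1 - P to be
  cancellable.\<close>

lemma cq_neq_1: "cq \<noteq> 1" and cq_square_neq_1: "cq\<^sup>2 \<noteq> 1"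
proof -
  show "cq \<noteq> 1"
    using one_minus_cq_mult_inv by force
  have "cq \<noteq> - 1"
    by transfer (simp add: One_fract_def one_pCons eq_fract)
  with \<open>cq \<noteq> 1\<close> show "cq\<^sup>2 \<noteq> 1"
    by (simp add: power2_eq_1_iff)
qed

lemmas scalar_qderiv_unfold =
  scalar_qderiv_def[of x "set ys", unfolded Let_def]

lemmas V_intros =
  subalg.scal[of _ "gen ` insert x (set ys)", folded radial_on_def]
  subalg.add[of _ "gen ` insert x (set ys)", folded radial_on_def]
  subalg.mult[of _ "gen ` insert x (set ys)", folded radial_on_def]
  subalg_0[of "gen ` insert x (set ys)", folded radial_on_def]
  subalg_1[of "gen ` insert x (set ys)", folded radial_on_def]
  subalg_uminus[of _ "gen ` insert x (set ys)", folded radial_on_def]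
  subalg_sum[of _ _ "gen ` insert x (set ys)", folded radial_on_def]

lemma scalar_in_V: "a \<in> \<A> \<Longrightarrow> a \<in> V"
  by (rule subsetD[OF scalars_subset_radial_on])

lemma scalar_qderiv_in:
  assumes "a \<in> \<A>"
  shows "scalar_qderiv x (set ys) a \<in> V"
proof -
  have "(2 :: (coeff, 'v) radial) \<in> V"
    using V_intros(2)[of 1 1] V_intros(5) by simp
  then show ?thesis
    unfolding scalar_qderiv_unfold
    by (intro V_intros scalar_in_V[OF jackson_spec(1)] scalar_in_V[OF dilation_in] jackson_spec(1) square_in_scalar_gens
        anticomm_in_scalar_gens gen_in_radial_on cq_neq_1 cq_square_neq_1 assms insertI1 insertI2)
qed

lemma scalar_qderiv_add:
  assumes "a \<in> \<A>" "b \<in> \<A>"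
  shows "scalar_qderiv x (set ys) (a + b) = scalar_qderiv x (set ys) a + scalar_qderiv x (set ys) b"
  unfolding scalar_qderiv_unfold using assms
  by (simp add: jackson_add jackson_spec dilation_add square_in_scalar_gens anticomm_in_scalar_gens
      cq_neq_1 cq_square_neq_1 distrib_left sum.distrib)

lemma scalar_qderiv_scal_mult:
  assumes "a \<in> \<A>"
  shows "scalar_qderiv x (set ys) (scal c * a) = scal c * scalar_qderiv x (set ys) a"
  unfolding scalar_qderiv_unfold using assms
  by (simp add: jackson_scal_mult jackson_spec dilation_mult dilation_scal square_in_scalar_gens
      anticomm_in_scalar_gens cq_neq_1 cq_square_neq_1 distrib_left sum_distrib_left subalg.scal
      central_left_commute[OF central_scal, of c "b :: (coeff, 'v) radial" for b] mult.assoc)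

end

section \<open>Scalar operators under enlargement of the variable set\<close>

lemma dilation_restrict:
  assumes "radial_frame x ys" "radial_frame x zs" "set ys \<subseteq> set zs"
    and u: "u \<in> scalar_gens x (set zs)" and a: "a \<in> scalars x (set ys)"
  shows "dilation (scalar_gens x (set zs)) u P a =
    (if u \<in> scalar_gens x (set ys) then dilation (scalar_gens x (set ys)) u P a else a)"
proof -
  interpret Y: radial_frame x ys by fact
  interpret Z: radial_frame x zs by fact
  have mono: "b \<in> scalars x (set ys) \<Longrightarrow> b \<in> scalars x (set zs)"
    "b \<in> scalar_gens x (set ys) \<Longrightarrow> b \<in> scalar_gens x (set zs)" for b
    using scalars_mono[OF assms(3)] scalar_gens_mono[OF assms(3)] by blast+
  show ?thesis
    using a
  proof induction
    case (scal c)
    show ?case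
      using u by (simp add: Y.dilation_scal Z.dilation_scal)
  next
    case (gen g)
    then show ?case
      using u by (auto simp: Y.dilation_gen Z.dilation_gen mono)
  next
    case (add a b)
    then show ?case
      using u by (auto simp: Y.dilation_add Z.dilation_add mono)
  next
    case (mult a b)
    then show ?case
      using u by (auto simp: Y.dilation_mult Z.dilation_mult mono)
  qed
qed

text \<open>The quotient over the smaller ring solves the defining equation over the larger one,
  where the solution is unique. If \<open>u\<close> does not occur in the smaller ring,
  \<open>a\<close> is fixed by the dilation and the quotient is 0.\<close>

lemma jackson_restrict:
  assumes "radial_frame x ys" "radial_frame x zs" "set ys \<subseteq> set zs"
    and u: "u \<in> scalar_gens x (set zs)" and P: "P \<noteq> 1" and a: "a \<in> scalars x (set ys)"
  shows "jackson (scalar_gens x (set zs)) u P a =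
    (if u \<in> scalar_gens x (set ys) then jackson (scalar_gens x (set ys)) u P a else 0)"
proof -
  interpret Y: radial_frame x ys by fact
  interpret Z: radial_frame x zs by fact
  have mono: "b \<in> scalars x (set ys) \<Longrightarrow> b \<in> scalars x (set zs)" for b
    using scalars_mono[OF assms(3)] by blast
  show ?thesis
    by (rule Z.jackson_eqI)
      (use u P a in \<open>simp_all add: mono subalg_0 Y.jackson_spec dilation_restrict[OF assms(1-3)]\<close>)
qed

lemma scalar_qderiv_restrict:
  assumes "radial_frame x ys" "radial_frame x zs" "set ys \<subseteq> set zs" "a \<in> scalars x (set ys)"
  shows "scalar_qderiv x (set zs) a = scalar_qderiv x (set ys) a"
proof -
  interpret Y: radial_frame x ys by fact
  interpret Z: radial_frame x zs by fact
  note restrict = dilation_restrict[OF assms(1-3)] jackson_restrict[OF assms(1-3)]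
  have "(\<Sum>y \<in> set zs. gen y * dilation (scalar_gens x (set zs)) ((gen x)\<^sup>2) (cq\<^sup>2)
        (jackson (scalar_gens x (set zs)) (anticomm (gen x) (gen y)) cq a)) =
      (\<Sum>y \<in> set ys. gen y * dilation (scalar_gens x (set zs)) ((gen x)\<^sup>2) (cq\<^sup>2)
        (jackson (scalar_gens x (set zs)) (anticomm (gen x) (gen y)) cq a))"
  proof (rule sum.mono_neutral_right)
    show "\<forall>y \<in> set zs - set ys. gen y * dilation (scalar_gens x (set zs)) ((gen x)\<^sup>2) (cq\<^sup>2)
        (jackson (scalar_gens x (set zs)) (anticomm (gen x) (gen y)) cq a) = 0"
    proof
      fix z
      assume z: "z \<in> set zs - set ys"
      then have "anticomm (gen x) (gen z) \<notin> scalar_gens x (set ys)"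
        using Z.distinct by (intro Y.anticomm_notin_scalar_gens) auto
      then have "jackson (scalar_gens x (set zs)) (anticomm (gen x) (gen z)) cq a = 0"
        using z assms(4) by (simp add: restrict Z.anticomm_in_scalar_gens Z.cq_neq_1)
      then show "gen z * dilation (scalar_gens x (set zs)) ((gen x)\<^sup>2) (cq\<^sup>2)
          (jackson (scalar_gens x (set zs)) (anticomm (gen x) (gen z)) cq a) = 0"
        \<comment> \<open>Dilations fix constants, in particular \<open>scal 0\<close>.\<close>
        using Z.dilation_scal[OF Z.square_in_scalar_gens, of "cq\<^sup>2" 0] by simp
    qed
  qed (use assms(3) in auto)
  also have "\<dots> = (\<Sum>y \<in> set ys. gen y * dilation (scalar_gens x (set ys)) ((gen x)\<^sup>2) (cq\<^sup>2)
        (jackson (scalar_gens x (set ys)) (anticomm (gen x) (gen y)) cq a))"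
    using assms(3,4)
    by (intro sum.cong) (auto simp: restrict Y.jackson_spec Z.cq_neq_1 subset_iff
        Y.anticomm_in_scalar_gens Z.anticomm_in_scalar_gens
        Y.square_in_scalar_gens Z.square_in_scalar_gens)
  finally show ?thesis
    unfolding scalar_qderiv_def Let_def using assms(4)
    by (simp add: restrict Z.cq_square_neq_1 Y.square_in_scalar_gens Z.square_in_scalar_gens)
qed


section \<open>Permuting the factors of a wedge product\<close>

text \<open>Reindexing the defining sum by \<open>\<sigma> \<circ> \<pi>\<close>; the sign is
  multiplicative and its own inverse.\<close>

lemma wedge_permute_list:
  assumes \<sigma>: "\<sigma> permutes {..<length us}"
  shows "wedge (permute_list \<sigma> us) = of_int (sign \<sigma>) * wedge us"
proof -
  let ?n = "length us"
  let ?p = "\<lambda>\<pi>. prod_list (map (\<lambda>i. us ! \<pi> i) [0..<?n])"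
  have term_eq: "of_int (sign \<pi>) * prod_list (map (\<lambda>i. permute_list \<sigma> us ! \<pi> i) [0..<?n]) =
      of_int (sign \<sigma>) * (of_int (sign (\<sigma> \<circ> \<pi>)) * ?p (\<sigma> \<circ> \<pi>))" if \<pi>: "\<pi> permutes {..<?n}" for \<pi>
  proof -
    have "permute_list \<sigma> us ! \<pi> i = us ! (\<sigma> \<circ> \<pi>) i" if "i < ?n" for i
      using permute_list_nth[OF \<sigma>, of "\<pi> i"] permutes_in_image[OF \<pi>, of i] that by simp
    then have "map (\<lambda>i. permute_list \<sigma> us ! \<pi> i) [0..<?n] = map (\<lambda>i. us ! (\<sigma> \<circ> \<pi>) i) [0..<?n]"
      by simp
    moreover have "sign (\<sigma> \<circ> \<pi>) = sign \<sigma> * sign \<pi>"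
      using \<sigma> \<pi> by (intro sign_compose) (auto simp: permutation_permutes)
    then have "of_int (sign \<pi>) = of_int (sign \<sigma>) * (of_int (sign (\<sigma> \<circ> \<pi>)) :: 'a)"
      by (simp flip: of_int_mult mult.assoc)
    ultimately show ?thesis
      by (simp only: mult.assoc)
  qed
  have "(\<Sum>\<pi> | \<pi> permutes {..<?n}.
      of_int (sign \<pi>) * prod_list (map (\<lambda>i. permute_list \<sigma> us ! \<pi> i) [0..<?n])) =
    of_int (sign \<sigma>) * (\<Sum>\<pi> | \<pi> permutes {..<?n}. of_int (sign (\<sigma> \<circ> \<pi>)) * ?p (\<sigma> \<circ> \<pi>))"
    unfolding sum_distrib_left by (rule sum.cong) (simp_all only: mem_Collect_eq term_eq)
  also have "(\<Sum>\<pi> | \<pi> permutes {..<?n}. of_int (sign (\<sigma> \<circ> \<pi>)) * ?p (\<sigma> \<circ> \<pi>)) =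
    (\<Sum>\<pi> | \<pi> permutes {..<?n}. of_int (sign \<pi>) * ?p \<pi>)"
    by (rule setum_permutations_compose_left[OF \<sigma>, symmetric])
  finally show ?thesis
    by (simp add: wedge_def)
qed

text \<open>The prefix \<open>ws\<close> covers the products with x kept in front while the
  y-letters are rearranged. Induction over transpositions suffices, since shifting a transposition
  by the length of the prefix gives a transposition again.\<close>

lemma wedge_append_permute_list:
  assumes "\<pi> permutes {..<length us}"
  shows "wedge (ws @ permute_list \<pi> us) = of_int (sign \<pi>) * wedge (ws @ us)"
  using finite_lessThan assms
proof (induction rule: permutes_rev_induct)
  case id
  show ?case
    by simp
next
  case (swap a b p)
  let ?t = "transpose a b" and ?T = "transpose (length ws + a) (length ws + b)"
  let ?us = "permute_list p us"
  have t: "?t permutes {..<length us}" and T: "?T permutes {..<length (ws @ ?us)}"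
    using swap by (auto intro: permutes_swap_id)
  have "ws @ permute_list ?t ?us = permute_list ?T (ws @ ?us)"
  proof (rule nth_equalityI)
    fix i
    assume i: "i < length (ws @ permute_list ?t ?us)"
    have "?T i = (if i < length ws then i else length ws + ?t (i - length ws))"
      unfolding transpose_def by auto
    then show "(ws @ permute_list ?t ?us) ! i = permute_list ?T (ws @ ?us) ! i"
      using i t T by (simp add: permute_list_nth nth_append)
  qed simp
  then have "wedge (ws @ permute_list ?t ?us) = of_int (sign ?T) * wedge (ws @ ?us)"
    using wedge_permute_list[OF T] by simp
  moreover have "sign (p \<circ> ?t) = sign p * sign ?t"
    using swap by (intro sign_compose permutation_swap_id) (auto simp: permutation_permutes)
  moreover have "permute_list (p \<circ> ?t) us = permute_list ?t ?us"
    using swap by (intro permute_list_compose permutes_swap_id) auto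
  moreover have "sign ?T = -1" "sign ?t = -1"
    using swap by (simp_all add: sign_swap_id)
  ultimately show ?case
    using swap.IH by (simp only:) simp
qed


section \<open>The basis of wedge products\<close>

lemma scal_of_int: "scal (of_int k) = (of_int k :: ('k::comm_ring_1, 'v) radial)"
proof -
  have "scal (of_nat n) = (of_nat n :: ('k, 'v) radial)" for n
    by (induction n) (simp_all add: scal_add)
  then show ?thesis
    by (cases k rule: int_diff_cases) (simp add: scal_add scal_uminus diff_conv_add_uminus del: add_uminus_conv_diff)
qed

lemma mset_nths_exists:
  assumes "distinct us" "set us \<subseteq> set vs" "distinct vs"
  shows "\<exists>I \<subseteq> {..<length vs}. mset us = mset (nths vs I)"
proof (intro exI conjI)
  let ?I = "{i. i < length vs \<and> vs ! i \<in> set us}"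
  show "?I \<subseteq> {..<length vs}"
    by auto
  have "set us = set (nths vs ?I)"
  proof (intro equalityI subsetI)
    fix u
    assume "u \<in> set us"
    moreover from this obtain i where "i < length vs" "vs ! i = u"
      using assms(2) by (metis in_set_conv_nth subsetD)
    ultimately show "u \<in> set (nths vs ?I)"
      by (auto simp: set_nths)
  qed (auto simp: set_nths)
  then show "mset us = mset (nths vs ?I)"
    using assms by (simp add: set_eq_iff_mset_eq_distinct distinct_nthsI)
qed

context radial_frame
begin

text \<open>
  Anticommutators being scalars, the letters of a word of length \<open>n\<close> anticommute modulo \<open>low n\<close>.
\<close>

inductive_set low :: "nat \<Rightarrow> (coeff, 'v) radial set" for n where
  zero: "0 \<in> low n"
| word: "set us \<subseteq> insert x (set ys) \<Longrightarrow> length us < n \<Longrightarrow> a \<in> \<A> \<Longrightarrow> prod_list (map gen us) * a \<in> low n"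
| add: "e \<in> low n \<Longrightarrow> e' \<in> low n \<Longrightarrow> e + e' \<in> low n"

lemma low_mono: "n \<le> n' \<Longrightarrow> e \<in> low n \<Longrightarrow> e \<in> low n'"
  by (rotate_tac, induction rule: low.induct) (auto intro: low.intros)

lemma low_scalar: "e \<in> low n \<Longrightarrow> a \<in> \<A> \<Longrightarrow> e * a \<in> low n"
  by (induction rule: low.induct)
    (auto simp: mult.assoc distrib_right intro: low.intros subalg.mult)

lemma low_scaleR: "e \<in> low n \<Longrightarrow> c *\<^sub>R e \<in> low n"
  using low_scalar[of e n "scal (of_real c)"] by (simp add: scaleR_radial_def scal_central subalg.scal)

lemma low_diff: "e \<in> low n \<Longrightarrow> e' \<in> low n \<Longrightarrow> e - e' \<in> low n"
  using low.add[of e n "(-1) *\<^sub>R e'"] low_scaleR[of e' n "-1"] by simp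

lemma low_of_int: "e \<in> low n \<Longrightarrow> of_int c * e \<in> low n"
  using low_scaleR[of e n "of_int c"] by (simp add: scaleR_conv_of_real)

lemma low_sum: "(\<And>i. i \<in> A \<Longrightarrow> f i \<in> low n) \<Longrightarrow> sum f A \<in> low n"
  by (induction A rule: infinite_finite_induct) (auto intro: low.intros)

lemma low_word_left:
  assumes "e \<in> low n" "set us \<subseteq> insert x (set ys)" "length us + n \<le> k"
  shows "prod_list (map gen us) * e \<in> low k"
  using assms(1)
proof induction
  case (word vs a)
  then show ?case
    using assms low.word[of "us @ vs" k a] by (simp add: mult.assoc)
qed (auto simp: distrib_left intro: low.intros)

lemma low_word_right:
  assumes "e \<in> low n" "set us \<subseteq> insert x (set ys)" "length us + n \<le> k"
  shows "e * prod_list (map gen us) \<in> low k"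
  using assms(1)
proof induction
  case (word vs a)
  then have "a * prod_list (map gen us) = prod_list (map gen us) * a"
    by (intro centralD central_scalars)
  then show ?case
    using word assms low.word[of "vs @ us" k a] by (simp add: mult.assoc)
qed (auto simp: distrib_right intro: low.intros)

text \<open>Moving \<open>u\<close> past \<open>v\<close> costs {u, v} times the remaining letters;
  this is a scalar times a word two letters shorter, hence low.\<close>

lemma move_letter:
  assumes "set (u # us) \<subseteq> insert x (set ys)"
  shows "gen u * prod_list (map gen us) - (-1) ^ length us * prod_list (map gen us) * gen u
    \<in> low (Suc (length us))"
  using assms
proof (induction us)
  case Nil
  show ?case
    by (simp add: low.zero)
next
  case (Cons v us)
  let ?w = "prod_list (map gen us) :: (coeff, 'v) radial" and ?s = "(-1) ^ length us :: (coeff, 'v) radial"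
  have "central ?s"
    by (induction us) (auto simp: central_1 central_mult central_def)
  then have s: "?s * (gen v * b) = gen v * (?s * b)" for b
    by (rule central_left_commute)
  have "anticomm (gen u) (gen v) \<in> \<A>"
    using Cons.prems by (intro anticomm_in_scalars) auto
  moreover from this have "anticomm (gen u) (gen v) * ?w = ?w * anticomm (gen u) (gen v)"
    by (intro centralD central_scalars)
  ultimately have 1: "anticomm (gen u) (gen v) * ?w \<in> low (Suc (length (v # us)))"
    using Cons.prems by (auto intro: low.word)
  have "prod_list (map gen [v]) * (gen u * ?w - ?s * ?w * gen u) \<in> low (Suc (length (v # us)))"
    using Cons by (intro low_word_left[of _ "Suc (length us)"]) auto
  then have "anticomm (gen u) (gen v) * ?w - gen v * (gen u * ?w - ?s * ?w * gen u)
      \<in> low (Suc (length (v # us)))"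
    using 1 by (intro low_diff) simp_all
  moreover have "anticomm (gen u) (gen v) * ?w - gen v * (gen u * ?w - ?s * ?w * gen u) =
      gen u * (gen v * ?w) - - ?s * (gen v * ?w) * gen u"
    by (simp add: anticomm_def algebra_simps s)
  ultimately show ?case
    by simp
qed

text \<open>Moving the left letter through the middle word w in both products leaves, up to sign, w
  {u, v}, which is low itself.\<close>

lemma swap_outer_letters:
  assumes "set (u # us @ [v]) \<subseteq> insert x (set ys)"
  shows "gen u * prod_list (map gen us) * gen v + gen v * prod_list (map gen us) * gen u
    \<in> low (length us + 2)"
proof -
  let ?w = "prod_list (map gen us) :: (coeff, 'v) radial" and ?s = "(-1) ^ length us :: (coeff, 'v) radial"
  have "(gen u' * ?w - ?s * ?w * gen u') * prod_list (map gen [v']) \<in> low (length us + 2)"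
    if "set (u' # us @ [v']) \<subseteq> insert x (set ys)" for u' v'
    using that by (intro low_word_right[OF move_letter]) simp_all
  then have "(gen u * ?w - ?s * ?w * gen u) * prod_list (map gen [v]) \<in> low (length us + 2)"
    "(gen v * ?w - ?s * ?w * gen v) * prod_list (map gen [u]) \<in> low (length us + 2)"
    using assms by auto
  moreover have "?w * anticomm (gen u) (gen v) \<in> low (length us + 2)"
    using assms by (intro low.word anticomm_in_scalars) auto
  then have "?s * (?w * anticomm (gen u) (gen v)) \<in> low (length us + 2)"
    using low_of_int[of _ _ "(-1) ^ length us"] by fastforce
  ultimately have "(gen u * ?w - ?s * ?w * gen u) * gen v + (gen v * ?w - ?s * ?w * gen v) * gen u +
      ?s * (?w * anticomm (gen u) (gen v)) \<in> low (length us + 2)"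
    by (intro low.add) simp_all
  then show ?thesis
    by (simp add: anticomm_def algebra_simps)
qed

lemma swap_letters:
  assumes "set (ws @ [u] @ us @ [v] @ vs) \<subseteq> insert x (set ys)"
  shows "prod_list (map gen (ws @ [u] @ us @ [v] @ vs)) + prod_list (map gen (ws @ [v] @ us @ [u] @ vs))
    \<in> low (length (ws @ [u] @ us @ [v] @ vs))"
proof -
  let ?w = "\<lambda>us. prod_list (map gen us) :: (coeff, 'v) radial"
  have "gen u * ?w us * gen v + gen v * ?w us * gen u \<in> low (length us + 2)"
    using assms by (intro swap_outer_letters) simp
  from low_word_right[OF this]
  have "(gen u * ?w us * gen v + gen v * ?w us * gen u) * ?w vs \<in> low (length us + 2 + length vs)"
    using assms by simp
  then have "?w ws * ((gen u * ?w us * gen v + gen v * ?w us * gen u) * ?w vs)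
      \<in> low (length (ws @ [u] @ us @ [v] @ vs))"
    by (rule low_word_left) (use assms in simp_all)
  then show ?thesis
    by (simp add: algebra_simps)
qed

lemma transpose_letters:
  assumes us: "set us \<subseteq> insert x (set ys)" and ij: "i < j" "j < length us"
  shows "prod_list (map gen (permute_list (transpose i j) us)) + prod_list (map gen us) \<in> low (length us)"
proof -
  define as bs cs where "as = take i us" and "bs = take (j - Suc i) (drop (Suc i) us)"
    and "cs = drop (Suc j) us"
  have "us = as @ [us ! i] @ drop (Suc i) us"
    using ij by (simp add: as_def id_take_nth_drop)
  also have "drop (Suc i) us = bs @ [us ! j] @ cs"
    using ij id_take_nth_drop[of "j - Suc i" "drop (Suc i) us"] by (simp add: bs_def cs_def)
  finally have us_eq: "us = as @ [us ! i] @ bs @ [us ! j] @ cs" .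
  have len: "length as = i" "length bs = j - Suc i"
    using ij by (simp_all add: as_def bs_def)
  have t: "transpose i j permutes {..<length us}"
    using ij by (intro permutes_swap_id) auto
  have "permute_list (transpose i j) us = as @ [us ! j] @ bs @ [us ! i] @ cs"
  proof (rule nth_equalityI)
    show "length (permute_list (transpose i j) us) = length (as @ [us ! j] @ bs @ [us ! i] @ cs)"
      using arg_cong[OF us_eq, of length] by simp
    fix k
    assume k: "k < length (permute_list (transpose i j) us)"
    have nth: "(as @ [a] @ bs @ [b] @ cs) ! l =
        (if l < i then as ! l else if l = i then a else if l < j then bs ! (l - Suc i)
         else if l = j then b else cs ! (l - Suc j))" for a b l
      using len ij by (auto simp: nth_append nth_Cons' intro!: arg_cong[of _ _ "nth cs"])
    have "(as @ [us ! i] @ bs @ [us ! j] @ cs) ! transpose i j k = (as @ [us ! j] @ bs @ [us ! i] @ cs) ! k"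
      unfolding nth using ij by (auto simp: transpose_def)
    then have "us ! transpose i j k = (as @ [us ! j] @ bs @ [us ! i] @ cs) ! k"
      by (simp only: us_eq[symmetric])
    then show "permute_list (transpose i j) us ! k = (as @ [us ! j] @ bs @ [us ! i] @ cs) ! k"
      using k t by (simp add: permute_list_nth)
  qed
  then show ?thesis
    using swap_letters[of as "us ! i" bs "us ! j" cs] us
    by (simp only: add.commute flip: us_eq)
qed

lemma permute_letters:
  assumes "\<pi> permutes {..<length us}" "set us \<subseteq> insert x (set ys)"
  shows "prod_list (map gen (permute_list \<pi> us)) - of_int (sign \<pi>) * prod_list (map gen us)
    \<in> low (length us)"
  using finite_lessThan assms(1)
proof (induction rule: permutes_rev_induct)
  case id
  show ?case
    by (simp add: low.zero)
next
  case (swap a b p)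
  let ?us = "permute_list p us"
  have set: "set ?us \<subseteq> insert x (set ys)"
    using swap assms(2) by simp
  have "prod_list (map gen (permute_list (transpose a b) ?us)) + prod_list (map gen ?us) \<in> low (length us)"
    using transpose_letters[OF set, of a b] transpose_letters[OF set, of b a] swap
    by (cases "a < b") (simp_all add: transpose_commute)
  from low_diff[OF this swap.IH]
  have "prod_list (map gen (permute_list (transpose a b) ?us)) + of_int (sign p) * prod_list (map gen us)
      \<in> low (length us)"
    by simp
  moreover have "sign (p \<circ> transpose a b) = sign p * sign (transpose a b)"
    using swap by (intro sign_compose permutation_swap_id) (auto simp: permutation_permutes)
  then have "sign (p \<circ> transpose a b) = - sign p"
    using swap by (simp add: sign_swap_id)
  moreover have "permute_list (p \<circ> transpose a b) us = permute_list (transpose a b) ?us"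
    using swap by (intro permute_list_compose permutes_swap_id) auto
  ultimately show ?case
    by (simp only:) simp
qed

text \<open>Modulo shorter words each of the n! signed summands equals the word itself, and the
  normalisation by n! makes the leading coefficient 1.\<close>

lemma wedge_minus_word:
  assumes "set us \<subseteq> insert x (set ys)"
  shows "wedge (map gen us) - prod_list (map gen us) \<in> low (length us)"
proof -
  let ?n = "length us" and ?w = "prod_list (map gen us) :: (coeff, 'v) radial"
  let ?P = "{\<pi>. \<pi> permutes {..<?n}}"
  have "(1 / fact ?n) *\<^sub>R
      (\<Sum>\<pi> \<in> ?P. of_int (sign \<pi>) * (prod_list (map gen (permute_list \<pi> us)) - of_int (sign \<pi>) * ?w))
      \<in> low ?n"
    by (intro low_scaleR low_sum low_of_int permute_letters) (use assms in auto)
  also have "(\<Sum>\<pi> \<in> ?P. of_int (sign \<pi>) * (prod_list (map gen (permute_list \<pi> us)) - of_int (sign \<pi>) * ?w)) =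
      (\<Sum>\<pi> \<in> ?P. of_int (sign \<pi>) * prod_list (map (\<lambda>i. map gen us ! \<pi> i) [0..<?n]) - ?w)"
  proof (rule sum.cong)
    fix \<pi>
    assume "\<pi> \<in> ?P"
    then have "(map gen (permute_list \<pi> us) :: (coeff, 'v) radial list) = map (\<lambda>i. map gen us ! \<pi> i) [0..<?n]"
      by (auto simp: permute_list_def dest: permutes_in_image[THEN iffD2])
    moreover have "of_int (sign \<pi>) * (of_int (sign \<pi>) * ?w) = ?w"
      by (simp flip: mult.assoc of_int_mult)
    ultimately show "of_int (sign \<pi>) * (prod_list (map gen (permute_list \<pi> us)) - of_int (sign \<pi>) * ?w) =
        of_int (sign \<pi>) * prod_list (map (\<lambda>i. map gen us ! \<pi> i) [0..<?n]) - ?w"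
      by (simp only: right_diff_distrib)
  qed simp
  also have "\<dots> = (\<Sum>\<pi> \<in> ?P. of_int (sign \<pi>) * prod_list (map (\<lambda>i. map gen us ! \<pi> i) [0..<?n])) -
      fact ?n *\<^sub>R ?w"
    by (simp add: sum_subtractf card_permutations scaleR_conv_of_real)
  finally show ?thesis
    by (simp add: wedge_def scaleR_diff_right)
qed

section \<open>Wedge products span over the scalars\<close>

abbreviation "index_sets \<equiv> Pow {..<length (x # ys)}"

text \<open>Taking positions in \<open>x # ys\<close> merges both families: \<open>I\<close>
  contains \<open>0\<close> for the elements x wedge y_J and omits it for y_J.\<close>

definition basis :: "nat set \<Rightarrow> (coeff, 'v) radial" where
  "basis I = wedge (map gen (nths (x # ys) I))"

lemma set_nths_frame: "set (nths (x # ys) I) \<subseteq> insert x (set ys)"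
  using set_nths_subset[of "x # ys" I] by simp

lemma length_nths_frame: "I \<in> index_sets \<Longrightarrow> length (nths (x # ys) I) = card I"
  unfolding length_nths by (rule arg_cong[of _ _ card]) auto

definition wedge_span :: "(coeff, 'v) radial set" where
  "wedge_span = {\<Sum>I \<in> index_sets. basis I * \<kappa> I | \<kappa>. \<forall>I. \<kappa> I \<in> \<A>}"

lemma wedge_span_0: "0 \<in> wedge_span"
  unfolding wedge_span_def by (rule CollectI, rule exI[of _ "\<lambda>_. 0"]) (simp add: subalg_0)

lemma wedge_span_add:
  assumes "a \<in> wedge_span" "b \<in> wedge_span"
  shows "a + b \<in> wedge_span"
proof -
  obtain \<kappa> \<kappa>' where "\<forall>I. \<kappa> I \<in> \<A>" "a = (\<Sum>I \<in> index_sets. basis I * \<kappa> I)"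
    "\<forall>I. \<kappa>' I \<in> \<A>" "b = (\<Sum>I \<in> index_sets. basis I * \<kappa>' I)"
    using assms unfolding wedge_span_def by blast
  then show ?thesis
    unfolding wedge_span_def
    by (intro CollectI exI[of _ "\<lambda>I. \<kappa> I + \<kappa>' I"]) (simp add: distrib_left sum.distrib subalg.add)
qed

lemma wedge_span_scalar:
  assumes "a \<in> wedge_span" "b \<in> \<A>"
  shows "a * b \<in> wedge_span"
proof -
  obtain \<kappa> where "\<forall>I. \<kappa> I \<in> \<A>" "a = (\<Sum>I \<in> index_sets. basis I * \<kappa> I)"
    using assms unfolding wedge_span_def by blast
  then show ?thesis
    unfolding wedge_span_def using assms(2)
    by (intro CollectI exI[of _ "\<lambda>I. \<kappa> I * b"]) (simp add: sum_distrib_right mult.assoc subalg.mult)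
qed

lemma basis_in_wedge_span:
  assumes "I \<in> index_sets"
  shows "basis I \<in> wedge_span"
proof -
  have "(\<Sum>J \<in> index_sets. basis J * (if I = J then 1 else 0)) = basis I"
    using assms by (simp add: if_distrib cong: if_cong)
  then show ?thesis
    unfolding wedge_span_def by (intro CollectI exI[of _ "\<lambda>J. if I = J then 1 else 0"])
      (simp add: subalg_0 subalg_1)
qed

text \<open>Induction on length, where low terms are already covered. A word without repetition is,
  up to sign and low terms, a basis element; a word with a repeated letter is low
  altogether.\<close>

lemma word_in_wedge_span: "set us \<subseteq> insert x (set ys) \<Longrightarrow> prod_list (map gen us) \<in> wedge_span"
proof (induction us rule: length_induct)
  case (1 us)
  let ?w = "\<lambda>us. prod_list (map gen us) :: (coeff, 'v) radial"
  have low: "e \<in> wedge_span" if "e \<in> low (length us)" for e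
    using that
  proof induction
    case (word vs a)
    then show ?case
      using 1 by (intro wedge_span_scalar) blast+
  qed (auto intro: wedge_span_0 wedge_span_add)
  show ?case
  proof (cases "distinct us")
    case True
    obtain I where I: "I \<in> index_sets" and mset: "mset us = mset (nths (x # ys) I)"
      using mset_nths_exists[OF True _ distinct] 1 by auto
    let ?vs = "nths (x # ys) I"
    from mset obtain \<pi> where \<pi>: "\<pi> permutes {..<length ?vs}" "permute_list \<pi> ?vs = us"
      by (rule mset_eq_permutation)
    have len: "length ?vs = length us"
      using \<pi>(2) by auto
    have "?w us - of_int (sign \<pi>) * ?w ?vs \<in> low (length us)"
      using permute_letters[OF \<pi>(1) set_nths_frame] \<pi>(2) len by simp
    moreover have "of_int (sign \<pi>) * (basis I - ?w ?vs) \<in> low (length us)"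
      using wedge_minus_word[OF set_nths_frame, of I] unfolding basis_def len by (rule low_of_int)
    ultimately have "(?w us - of_int (sign \<pi>) * ?w ?vs) - of_int (sign \<pi>) * (basis I - ?w ?vs) \<in> low (length us)"
      by (rule low_diff)
    then have "?w us - of_int (sign \<pi>) * basis I \<in> low (length us)"
      by (simp add: right_diff_distrib)
    then have "?w us - of_int (sign \<pi>) * basis I \<in> wedge_span"
      by (rule low)
    moreover have "basis I * scal (of_int (sign \<pi>)) \<in> wedge_span"
      by (intro wedge_span_scalar basis_in_wedge_span I subalg.scal)
    ultimately have "(?w us - of_int (sign \<pi>) * basis I) + of_int (sign \<pi>) * basis I \<in> wedge_span"
      by (metis scal_central scal_of_int wedge_span_add)
    then show ?thesis
      by simp
  next
    case False
    then obtain as bs cs u where us: "us = as @ [u] @ bs @ [u] @ cs"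
      using not_distinct_decomp by blast
    \<comment> \<open>Swapping the two occurrences of \<open>u\<close> leaves the word unchanged, so
      twice the word is low.\<close>
    have "(1 / 2) *\<^sub>R (?w us + ?w us) \<in> low (length us)"
      using 1 swap_letters[of as u bs u cs] unfolding us by (intro low_scaleR) simp
    then have "?w us \<in> low (length us)"
      by (simp flip: scaleR_2)
    then show ?thesis
      by (rule low)
  qed
qed

lemma low_mult: "e \<in> low m \<Longrightarrow> e' \<in> low n \<Longrightarrow> e * e' \<in> low (m + n)"
proof (induction rule: low.induct)
  case (word us a)
  have "e' * a \<in> low n"
    using word by (intro low_scalar)
  then have "prod_list (map gen us) * (e' * a) \<in> low (m + n)"
    by (rule low_word_left) (use word in auto)
  moreover have "e' * a = a * e'"
    using word by (intro centralD[symmetric] central_scalars)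
  ultimately show ?case
    by (simp add: mult.assoc)
qed (auto simp: distrib_right intro: low.intros)

text \<open>Closure of the span under products is not visible directly, but the filtration
  \<open>low\<close> is multiplicative and so exhausts the algebra, and each of its members is a sum
  of words times scalars.\<close>

lemma radial_on_subset_wedge_span: "V \<subseteq> wedge_span"
proof
  fix a
  assume "a \<in> V"
  then have "\<exists>n. a \<in> low n"
    unfolding radial_on_def
  proof induction
    case (scal c)
    show ?case
      using low.word[of "[]" 1 "scal c"] by (auto intro: subalg.scal)
  next
    case (gen g)
    then obtain v where "v \<in> insert x (set ys)" "g = gen v"
      by blast
    then show ?case
      using low.word[of "[v]" 2 1] by (auto simp: subalg_1)
  next
    case (add a b)
    then obtain m n where "a \<in> low m" "b \<in> low n"
      by blast
    then show ?case
      by (intro exI[of _ "max m n"] low.add) (auto elim: low_mono[rotated])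
  next
    case (mult a b)
    then show ?case
      using low_mult by blast
  qed
  then obtain n where "a \<in> low n" ..
  then show "a \<in> wedge_span"
    by induction (auto intro: wedge_span_0 wedge_span_add wedge_span_scalar word_in_wedge_span)
qed

lemma wedge_expansion: "a \<in> V \<Longrightarrow> \<exists>\<kappa>. (\<forall>I. \<kappa> I \<in> \<A>) \<and> a = (\<Sum>I \<in> index_sets. basis I * \<kappa> I)"
  using radial_on_subset_wedge_span unfolding wedge_span_def by blast

section \<open>Wedge products are independent over the scalars\<close>

lemma foldr_letter:
  "set us \<subseteq> insert x (set ys) \<Longrightarrow> foldr letter us m = foldr (clifford sq pol (x # ys)) us m"
  by (induction us) (auto simp: letter_def)

lemma act_low:
  assumes "e \<in> low n" "finite I" "card I \<ge> n"
  shows "act e (unit_at {}) I = 0"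
  using assms(1)
proof induction
  case zero
  show ?case
    by (rule act_zero)
next
  case (word us a)
  have "act a (unit_at {}) = (\<lambda>I. symbol a * unit_at {} I)"
    using word by (intro ext act_scalar)
  then have "act (prod_list (map gen us) * a) (unit_at {}) I =
      symbol a * act (prod_list (map gen us)) (unit_at {}) I"
    by (simp add: act_mult act_smult)
  then show ?case
    using word assms(2,3) by (simp add: act_prod_list foldr_letter foldr_clifford_degree)
next
  case (add e e')
  then show ?case
    by (simp add: act_add)
qed

text \<open>The low part of the wedge product cannot reach index sets of this size, so only its
  leading word contributes, and that word hits exactly \<open>I\<close>.\<close>

lemma act_basis:
  assumes I: "I \<in> index_sets" and J: "finite J" "card I \<le> card J"
  shows "act (basis I) (unit_at {}) J = unit_at I J"
proof -
  let ?w = "prod_list (map gen (nths (x # ys) I)) :: (coeff, 'v) radial"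
  have "act ((basis I - ?w) + ?w) (unit_at {}) J = act ?w (unit_at {}) J"
    using act_low[OF wedge_minus_word[OF set_nths_frame[of I]] J(1)] J(2)
    unfolding act_add by (simp add: basis_def length_nths_frame[OF I])
  also have "\<dots> = unit_at I J"
    using I by (simp add: act_prod_list foldr_letter set_nths_frame foldr_clifford_unit[OF distinct])
  finally show ?thesis
    by simp
qed

text \<open>Descending induction on the size of \<open>I\<close>. In the component at
  \<open>I\<close> of the relation applied to the vacuum, coefficients of larger sets vanish by
  induction, and among the remaining sets only \<open>I\<close> itself contributes, with its
  symbol.\<close>

lemma basis_independent:
  assumes \<kappa>: "\<And>I. \<kappa> I \<in> \<A>" and sum: "(\<Sum>I \<in> index_sets. basis I * \<kappa> I) = 0"
    and "I \<in> index_sets"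
  shows "\<kappa> I = 0"
  using assms(3)
proof (induction "length (x # ys) - card I" arbitrary: I rule: less_induct)
  case less
  have fin: "finite J" "card J \<le> length (x # ys)" if "J \<in> index_sets" for J
    using that finite_subset[of J "{..<length (x # ys)}"] card_mono[of "{..<length (x # ys)}" J] by auto
  have term_eq: "act (basis J * \<kappa> J) (unit_at {}) I = (if J = I then symbol (\<kappa> J) else 0)"
    if J: "J \<in> index_sets" for J
  proof (cases "card J \<le> card I")
    case True
    have "act (\<kappa> J) (unit_at {}) = (\<lambda>K. symbol (\<kappa> J) * unit_at {} K)"
      using \<kappa> by (intro ext act_scalar)
    then show ?thesis
      using J less.prems True fin by (simp add: act_mult act_smult act_basis) (simp add: unit_at_def)
  next
    case False
    then have "\<kappa> J = 0"
      using J fin[OF J] by (intro less.hyps) auto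
    then show ?thesis
      using False by (auto simp: act_zero)
  qed
  have "0 = (\<Sum>J \<in> index_sets. act (basis J * \<kappa> J) (unit_at {}) I)"
    using arg_cong[OF sum, of "\<lambda>a. act a (unit_at {}) I"] by (simp add: act_sum act_zero)
  also have "\<dots> = (\<Sum>J \<in> index_sets. if J = I then symbol (\<kappa> J) else 0)"
    by (rule sum.cong[OF refl term_eq])
  also have "\<dots> = symbol (\<kappa> I)"
    using less.prems by simp
  finally show ?case
    using \<kappa> symbol_eq_0 by simp
qed

end


section \<open>The finite relative derivative\<close>

context radial_frame
begin

lemma word_in_V: "set us \<subseteq> insert x (set ys) \<Longrightarrow> prod_list (map gen us) \<in> V"
  by (induction us) (auto intro: V_intros gen_in_radial_on)

lemma wedge_in_V:
  assumes "set us \<subseteq> insert x (set ys)"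
  shows "wedge (map gen us) \<in> V"
proof -
  have low: "e \<in> V" if "e \<in> low n" for e n
    using that by induction (auto intro: V_intros word_in_V scalar_in_V)
  then have "(wedge (map gen us) - prod_list (map gen us)) + prod_list (map gen us) \<in> V"
    using assms by (intro V_intros word_in_V low[OF wedge_minus_word])
  then show ?thesis
    by simp
qed

lemma basis_in_V: "basis I \<in> V"
  unfolding basis_def by (rule wedge_in_V[OF set_nths_frame])

section \<open>Coordinates and extension from the basis\<close>

definition coord :: "(coeff, 'v) radial \<Rightarrow> nat set \<Rightarrow> (coeff, 'v) radial" where
  "coord a = (SOME \<kappa>. (\<forall>I. \<kappa> I \<in> \<A>) \<and> a = (\<Sum>I \<in> index_sets. basis I * \<kappa> I))"

lemma coord:
  assumes "a \<in> V"
  shows "coord a I \<in> \<A>" "a = (\<Sum>I \<in> index_sets. basis I * coord a I)"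
  using someI_ex[OF wedge_expansion[OF assms]] unfolding coord_def by blast+

lemma coord_eqI:
  assumes "a \<in> V" "\<And>I. \<kappa> I \<in> \<A>" "a = (\<Sum>I \<in> index_sets. basis I * \<kappa> I)" "I \<in> index_sets"
  shows "coord a I = \<kappa> I"
proof -
  have "(\<Sum>I \<in> index_sets. basis I * (coord a I - \<kappa> I)) = a - a"
    using assms(3) coord(2)[OF assms(1)] by (simp add: right_diff_distrib sum_subtractf)
  then have "coord a I - \<kappa> I = 0"
    using assms coord(1) by (intro basis_independent[of "\<lambda>I. coord a I - \<kappa> I"] subalg_diff) auto
  then show ?thesis
    by simp
qed

lemma coeff_linear_on_sum:
  assumes D: "coeff_linear_on V D" and f: "\<And>i. i \<in> B \<Longrightarrow> f i \<in> V"
  shows "D (sum f B) = (\<Sum>i \<in> B. D (f i))"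
proof -
  have "D 0 = 0"
    using D V_intros unfolding coeff_linear_on_def by (metis add_cancel_right_right)
  then show ?thesis
    using f
  proof (induction B rule: infinite_finite_induct)
    case (insert i B)
    then show ?case
      using D unfolding coeff_linear_on_def by (simp add: V_intros)
  qed simp_all
qed

lemma coeff_linear_on_eqI:
  assumes D: "coeff_linear_on V D" "coeff_linear_on V D'"
    and eq: "\<And>I a. I \<in> index_sets \<Longrightarrow> a \<in> \<A> \<Longrightarrow> D (basis I * a) = D' (basis I * a)"
    and a: "a \<in> V"
  shows "D a = D' a"
proof -
  have V: "basis I * coord a I \<in> V" for I
    using coord(1)[OF a] by (intro V_intros basis_in_V scalar_in_V)
  have "D (\<Sum>I \<in> index_sets. basis I * coord a I) = D' (\<Sum>I \<in> index_sets. basis I * coord a I)"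
    by (simp only: coeff_linear_on_sum D V) (rule sum.cong[OF refl eq[OF _ coord(1)[OF a]]])
  then show ?thesis
    by (simp only: flip: coord(2)[OF a])
qed

text \<open>The summands \<open>basis I\<close> times scalars are independent, so any family of maps
  on them glues. Only linearity over the coefficients is asked of \<open>E I\<close>, because
  q-derivatives are not linear over the scalars.\<close>

lemma linear_extension:
  assumes E_in: "\<And>I a. a \<in> \<A> \<Longrightarrow> E I a \<in> V"
    and E_add: "\<And>I a b. a \<in> \<A> \<Longrightarrow> b \<in> \<A> \<Longrightarrow> E I (a + b) = E I a + E I b"
    and E_scal: "\<And>I a c. a \<in> \<A> \<Longrightarrow> E I (scal c * a) = scal c * E I a"
  shows "\<exists>!D. D \<in> V \<rightarrow>\<^sub>E V \<and> coeff_linear_on V D \<and>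
    (\<forall>I \<in> index_sets. \<forall>a \<in> \<A>. D (basis I * a) = E I a)"
proof (rule ex_ex1I)
  define D where "D = (\<lambda>a \<in> V. \<Sum>I \<in> index_sets. E I (coord a I))"
  have "D a \<in> V" if "a \<in> V" for a
    using that by (auto simp: D_def intro!: V_intros E_in coord)
  then have "D \<in> V \<rightarrow>\<^sub>E V"
    by (auto simp: D_def)
  moreover have "coeff_linear_on V D"
    unfolding coeff_linear_on_def
  proof (intro conjI ballI allI)
    fix a b
    assume V: "a \<in> V" "b \<in> V"
    have "coord (a + b) I = coord a I + coord b I" if "I \<in> index_sets" for I
    proof (rule coord_eqI[OF _ _ _ that])
      show "a + b = (\<Sum>I \<in> index_sets. basis I * (coord a I + coord b I))"
        unfolding distrib_left sum.distrib using V coord(2) by simp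
    qed (use V in \<open>auto intro: V_intros subalg.add coord\<close>)
    then show "D (a + b) = D a + D b"
      using V by (simp add: D_def V_intros E_add coord(1) flip: sum.distrib)
  next
    fix c a
    assume V: "a \<in> V"
    have "coord (scal c * a) I = scal c * coord a I" if "I \<in> index_sets" for I
    proof (rule coord_eqI[OF _ _ _ that])
      have "scal c * a = scal c * (\<Sum>I \<in> index_sets. basis I * coord a I)"
        by (rule arg_cong[OF coord(2)[OF V]])
      also have "\<dots> = (\<Sum>I \<in> index_sets. basis I * (scal c * coord a I))"
        unfolding sum_distrib_left by (intro sum.cong refl central_left_commute central_scal)
      finally show "scal c * a = (\<Sum>I \<in> index_sets. basis I * (scal c * coord a I))" .
    qed (use V in \<open>auto intro: V_intros subalg.mult subalg.scal coord\<close>)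
    then show "D (scal c * a) = scal c * D a"
      using V by (simp add: D_def V_intros E_scal coord(1) sum_distrib_left)
  qed
  moreover have "D (basis I * a) = E I a" if I: "I \<in> index_sets" and a: "a \<in> \<A>" for I a
  proof -
    have V: "basis I * a \<in> V"
      using a by (intro V_intros basis_in_V scalar_in_V)
    have "coord (basis I * a) J = (if I = J then a else 0)" if "J \<in> index_sets" for J
    proof (rule coord_eqI[OF V _ _ that])
      show "basis I * a = (\<Sum>J \<in> index_sets. basis J * (if I = J then a else 0))"
        using I by (simp add: if_distrib cong: if_cong)
    qed (use a in \<open>auto intro: subalg_0\<close>)
    moreover have "E J 0 = 0" for J
      using E_scal[of 0 J 0] by (simp add: subalg_0)
    ultimately have "(\<Sum>J \<in> index_sets. E J (coord (basis I * a) J)) =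
        (\<Sum>J \<in> index_sets. if I = J then E J a else 0)"
      by (intro sum.cong) simp_all
    then show ?thesis
      using I V by (simp add: D_def)
  qed
  ultimately show "\<exists>D. D \<in> V \<rightarrow>\<^sub>E V \<and> coeff_linear_on V D \<and>
      (\<forall>I \<in> index_sets. \<forall>a \<in> \<A>. D (basis I * a) = E I a)"
    by blast
next
  fix D D'
  assume D: "D \<in> V \<rightarrow>\<^sub>E V \<and> coeff_linear_on V D \<and> (\<forall>I \<in> index_sets. \<forall>a \<in> \<A>. D (basis I * a) = E I a)"
    and D': "D' \<in> V \<rightarrow>\<^sub>E V \<and> coeff_linear_on V D' \<and> (\<forall>I \<in> index_sets. \<forall>a \<in> \<A>. D' (basis I * a) = E I a)"
  show "D = D'"
  proof (rule PiE_ext[of D V "\<lambda>_. V"])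
    show "D a = D' a" if "a \<in> V" for a
      by (rule coeff_linear_on_eqI[OF _ _ _ that]) (use D D' in auto)
  qed (use D D' in blast)+
qed

section \<open>The finite operator on basis elements\<close>

lemma basis_Suc:
  "basis (Suc ` J) = wedge (map gen (nths ys J))"
  "basis (insert 0 (Suc ` J)) = wedge (gen x # map gen (nths ys J))"
  by (simp_all add: basis_def nths_Cons_Suc)

lemma index_sets_Suc:
  "Suc ` J \<in> index_sets \<longleftrightarrow> J \<subseteq> {..<length ys}"
  "insert 0 (Suc ` J) \<in> index_sets \<longleftrightarrow> J \<subseteq> {..<length ys}"
  by auto

text \<open>Both defining formulas in one family over positions in \<open>x # ys\<close>. The set
  \<open>J\<close> drops x and shifts back, so \<open>card J\<close> is the degree p in [m - p] and
  q^(m - p).\<close>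

definition basis_qderiv :: "nat set \<Rightarrow> (coeff, 'v) radial \<Rightarrow> (coeff, 'v) radial" where
  "basis_qderiv I a = (let J = Suc -` I in
    if 0 \<in> I then (- 1) ^ card J * scal (qm_bracket (- int (card J))) * basis (Suc ` J) * a +
      scal (qm_power (- int (card J))) * basis I * scalar_qderiv x (set ys) a
    else basis I * scalar_qderiv x (set ys) a)"

lemma basis_qderiv_Suc:
  "basis_qderiv (Suc ` J) a = wedge (map gen (nths ys J)) * scalar_qderiv x (set ys) a"
  "basis_qderiv (insert 0 (Suc ` J)) a =
    (- 1) ^ card J * scal (qm_bracket (- int (card J))) * wedge (map gen (nths ys J)) * a +
    scal (qm_power (- int (card J))) * wedge (gen x # map gen (nths ys J)) * scalar_qderiv x (set ys) a"
  by (simp_all add: basis_qderiv_def vimage_Suc_insert basis_Suc image_iff)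

text \<open>The right-hand side is the condition inside \<open>finite_qderiv\<close>, so unique
  existence can be carried into its definite description by rewriting.\<close>

lemma basis_qderiv_spec:
  "(\<forall>I \<in> index_sets. \<forall>a \<in> \<A>. D (basis I * a) = basis_qderiv I a) \<longleftrightarrow>
    (\<forall>I. I \<subseteq> {..<length ys} \<longrightarrow>
      (\<forall>A\<in>\<A>. D (wedge (map gen (nths ys I)) * A) =
        wedge (map gen (nths ys I)) * scalar_qderiv x (set ys) A) \<and>
      (\<forall>B\<in>\<A>. D (wedge (gen x # map gen (nths ys I)) * B) =
        (- 1) ^ card I * scal (qm_bracket (- int (card I))) * wedge (map gen (nths ys I)) * B +
        scal (qm_power (- int (card I))) * wedge (gen x # map gen (nths ys I)) *
          scalar_qderiv x (set ys) B))"
  (is "?L \<longleftrightarrow> ?R")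
proof
  assume L: ?L
  have "D (basis (Suc ` J) * a) = basis_qderiv (Suc ` J) a"
    "D (basis (insert 0 (Suc ` J)) * a) = basis_qderiv (insert 0 (Suc ` J)) a"
    if "J \<subseteq> {..<length ys}" "a \<in> \<A>" for J a
    using L that by (simp_all only: index_sets_Suc)
  then show ?R
    unfolding basis_qderiv_Suc basis_Suc by blast
next
  assume R: ?R
  have "D (basis (Suc ` J) * a) = basis_qderiv (Suc ` J) a"
    "D (basis (insert 0 (Suc ` J)) * a) = basis_qderiv (insert 0 (Suc ` J)) a"
    if "J \<subseteq> {..<length ys}" "a \<in> \<A>" for J a
    using R that unfolding basis_qderiv_Suc basis_Suc by blast+
  then show ?L
    by (metis index_sets_Suc nat_set_cases)
qed

lemma finite_qderiv_spec:
  shows finite_qderiv_PiE: "finite_qderiv x ys \<in> V \<rightarrow>\<^sub>E V"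
    and finite_qderiv_linear: "coeff_linear_on V (finite_qderiv x ys)"
    and finite_qderiv_basis:
      "I \<in> index_sets \<Longrightarrow> a \<in> \<A> \<Longrightarrow> finite_qderiv x ys (basis I * a) = basis_qderiv I a"
proof -
  have minus_one: "(- 1 :: (coeff, 'v) radial) ^ k = scal ((-1) ^ k)" for k
    using scal_of_int[where 'k = coeff and 'v = 'v, of "(-1) ^ k"] by simp
  have "\<exists>!D. D \<in> V \<rightarrow>\<^sub>E V \<and> coeff_linear_on V D \<and>
      (\<forall>I \<in> index_sets. \<forall>a \<in> \<A>. D (basis I * a) = basis_qderiv I a)"
  proof (rule linear_extension)
    show "basis_qderiv I a \<in> V" if "a \<in> \<A>" for I a
      using that by (auto simp: basis_qderiv_def Let_def minus_one
          intro!: V_intros basis_in_V scalar_qderiv_in scalar_in_V[OF that])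
    show "basis_qderiv I (a + b) = basis_qderiv I a + basis_qderiv I b" if "a \<in> \<A>" "b \<in> \<A>" for I a b
      using that by (simp add: basis_qderiv_def Let_def scalar_qderiv_add distrib_left)
    show "basis_qderiv I (scal c * a) = scal c * basis_qderiv I a" if "a \<in> \<A>" for I a c
      using that by (simp add: basis_qderiv_def Let_def scalar_qderiv_scal_mult distrib_left
          central_left_commute[OF central_scal, of c b for b])
  qed
  from theI'[OF this[unfolded basis_qderiv_spec]]
  have "finite_qderiv x ys \<in> V \<rightarrow>\<^sub>E V \<and> coeff_linear_on V (finite_qderiv x ys) \<and>
      (\<forall>I \<in> index_sets. \<forall>a \<in> \<A>. finite_qderiv x ys (basis I * a) = basis_qderiv I a)"
    unfolding finite_qderiv_def Let_def basis_qderiv_spec .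
  then show "finite_qderiv x ys \<in> V \<rightarrow>\<^sub>E V" "coeff_linear_on V (finite_qderiv x ys)"
    "I \<in> index_sets \<Longrightarrow> a \<in> \<A> \<Longrightarrow> finite_qderiv x ys (basis I * a) = basis_qderiv I a"
    by blast+
qed

text \<open>This frees the defining formulas from the order of \<open>ys\<close>: the rearrangement
  sign is a constant, so linearity pulls it out of the operator, and on the other side every term
  contains one wedge product that absorbs it. Letters of a smaller list may be scattered and
  reordered in a larger one, so the comparison needs this form.\<close>

lemma finite_qderiv_wedge:
  assumes us: "distinct us" "set us \<subseteq> set ys" and a: "a \<in> \<A>"
  shows "finite_qderiv x ys (wedge (map gen us) * a) = wedge (map gen us) * scalar_qderiv x (set ys) a"
    and "finite_qderiv x ys (wedge (gen x # map gen us) * a) =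
      (- 1) ^ length us * scal (qm_bracket (- int (length us))) * wedge (map gen us) * a +
      scal (qm_power (- int (length us))) * wedge (gen x # map gen us) * scalar_qderiv x (set ys) a"
proof -
  let ?D = "finite_qderiv x ys"
  obtain J where J: "J \<subseteq> {..<length ys}" "mset us = mset (nths ys J)"
    using mset_nths_exists[of us ys] us distinct by auto
  let ?vs = "nths ys J"
  obtain \<pi> where \<pi>: "\<pi> permutes {..<length ?vs}" "permute_list \<pi> ?vs = us"
    using J(2) by (rule mset_eq_permutation)
  define s where "s = (of_int (sign \<pi>) :: coeff)"
  have "(map gen us :: (coeff, 'v) radial list) = permute_list \<pi> (map gen ?vs)"
    using \<pi> by (metis permute_list_map)
  then have wedge_us: "wedge (ws @ map gen us) = scal s * wedge (ws @ map gen ?vs)"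
    for ws :: "(coeff, 'v) radial list"
    using wedge_append_permute_list[of \<pi> "map gen ?vs" ws] \<pi>(1) by (simp add: s_def scal_of_int)
  have len: "length us = card J"
  proof -
    have "{i. i < length ys \<and> i \<in> J} = J"
      using J(1) by auto
    then show ?thesis
      using arg_cong[OF J(2), of size] by (simp add: length_nths)
  qed
  have scal: "?D (scal s * b) = scal s * ?D b" if "b \<in> V" for b
    using finite_qderiv_linear that unfolding coeff_linear_on_def by blast
  have D: "?D (scal s * basis I * a) = scal s * basis_qderiv I a" if "I \<in> index_sets" for I
    using that a by (simp add: mult.assoc scal finite_qderiv_basis V_intros basis_in_V scalar_in_V)
  show "?D (wedge (map gen us) * a) = wedge (map gen us) * scalar_qderiv x (set ys) a"
    using D[OF index_sets_Suc(1)[THEN iffD2, OF J(1)]] wedge_us[of "[]"]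
    by (simp add: basis_Suc basis_qderiv_Suc mult.assoc)
  have "?D (wedge (gen x # map gen us) * a) = scal s * basis_qderiv (insert 0 (Suc ` J)) a"
    using D[OF index_sets_Suc(2)[THEN iffD2, OF J(1)]] wedge_us[of "[gen x]"]
    by (simp add: basis_Suc)
  also have "\<dots> = (- 1) ^ length us * scal (qm_bracket (- int (length us))) * wedge (map gen us) * a +
      scal (qm_power (- int (length us))) * wedge (gen x # map gen us) * scalar_qderiv x (set ys) a"
    using wedge_us[of "[]"] wedge_us[of "[gen x]"]
    by (simp add: basis_qderiv_Suc len distrib_left mult.assoc
        central_left_commute[OF central_scal, of s b for b])
  finally show "?D (wedge (gen x # map gen us) * a) =
      (- 1) ^ length us * scal (qm_bracket (- int (length us))) * wedge (map gen us) * a +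
      scal (qm_power (- int (length us))) * wedge (gen x # map gen us) * scalar_qderiv x (set ys) a" .
qed

end

section \<open>Compatibility of the finite operators\<close>

lemma coeff_linear_on_subset: "coeff_linear_on W D \<Longrightarrow> V \<subseteq> W \<Longrightarrow> coeff_linear_on V D"
  unfolding coeff_linear_on_def by blast

text \<open>Two linear maps on the smaller algebra agree once they agree on its basis, where both
  follow the order-free formulas. The inclusion may be an equality, so the operator depends only on
  the set enumerated.\<close>

lemma finite_qderiv_restrict:
  assumes "radial_frame x ys" "radial_frame x zs" "set ys \<subseteq> set zs"
    and "a \<in> radial_on (insert x (set ys))"
  shows "finite_qderiv x zs a = finite_qderiv x ys a"
proof -
  interpret Y: radial_frame x ys by fact
  interpret Z: radial_frame x zs by fact
  show ?thesis
  proof (rule Y.coeff_linear_on_eqI[OF _ Y.finite_qderiv_linear _ assms(4)])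
    show "coeff_linear_on Y.V (finite_qderiv x zs)"
      using Z.finite_qderiv_linear by (rule coeff_linear_on_subset) (rule radial_on_mono, use assms(3) in auto)
    fix I b
    assume b: "b \<in> Y.\<A>"
    then have bZ: "b \<in> Z.\<A>"
      using scalars_mono[OF assms(3)] by blast
    have us: "distinct (nths ys J)" "set (nths ys J) \<subseteq> set ys" "set (nths ys J) \<subseteq> set zs" for J
      using Y.distinct assms(3) set_nths_subset[of ys J] by auto
    show "finite_qderiv x zs (Y.basis I * b) = finite_qderiv x ys (Y.basis I * b)"
      by (cases I rule: nat_set_cases)
        (simp_all add: Y.basis_Suc Y.finite_qderiv_wedge Z.finite_qderiv_wedge us b bZ
          scalar_qderiv_restrict[OF assms(1-3) b])
  qed
qed

section \<open>Gluing along the directed family of finite variable sets\<close>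

theorem theorem3p6:
  fixes S :: "'v set" and x :: 'v
  assumes "x \<in> S"
  shows "(\<forall>ys zs. distinct ys \<and> distinct zs \<and> set ys \<subseteq> set zs \<and> set zs \<subseteq> S - {x} \<longrightarrow>
      (\<forall>a \<in> radial_on (insert x (set ys)). finite_qderiv x zs a = finite_qderiv x ys a)) \<and>
    (\<exists>!D. D \<in> radial_on S \<rightarrow>\<^sub>E radial_on S \<and> coeff_linear_on (radial_on S) D \<and>
      (\<forall>ys. distinct ys \<and> set ys \<subseteq> S - {x} \<longrightarrow>
        (\<forall>a \<in> radial_on (insert x (set ys)). D a = finite_qderiv x ys a)))"
proof (rule conjI)
  have frame: "radial_frame x ys" if "distinct ys" "set ys \<subseteq> S - {x}" for ys
    using that by unfold_locales auto
  show compatible: "\<forall>ys zs. distinct ys \<and> distinct zs \<and> set ys \<subseteq> set zs \<and> set zs \<subseteq> S - {x} \<longrightarrow>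
      (\<forall>a \<in> radial_on (insert x (set ys)). finite_qderiv x zs a = finite_qderiv x ys a)"
    by (intro allI impI ballI finite_qderiv_restrict) (auto intro!: frame)
  define admissible where "admissible ys \<longleftrightarrow> distinct ys \<and> set ys \<subseteq> S - {x}" for ys
  define W where "W ys = (radial_on (insert x (set ys)) :: (coeff, 'v) radial set)" for ys
  \<comment> \<open>Directedness: enumerate the union of the two finite sets.\<close>
  have join: "\<exists>zs. admissible zs \<and> set ys \<subseteq> set zs \<and> set ys' \<subseteq> set zs"
    if "admissible ys" "admissible ys'" for ys ys'
    using that finite_distinct_list[of "set ys \<union> set ys'"] unfolding admissible_def by auto
  have W_mono: "a \<in> W ys \<Longrightarrow> set ys \<subseteq> set zs \<Longrightarrow> a \<in> W zs" for a ys zs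
    unfolding W_def using radial_on_mono[of "insert x (set ys)" "insert x (set zs)"] by blast
  have cover: "\<exists>ys. admissible ys \<and> a \<in> W ys" if a: "a \<in> radial_on S" for a
  proof -
    obtain T where T: "finite T" "T \<subseteq> S" "a \<in> radial_on T"
      using radial_on_finite[OF a] by blast
    then obtain ys where "set ys = T - {x}" "distinct ys"
      using finite_distinct_list[of "T - {x}"] by auto
    then show ?thesis
      using T radial_on_mono[of T "insert x (set ys)"] unfolding admissible_def W_def by blast
  qed
  have W_S: "W ys \<subseteq> radial_on S" if "admissible ys" for ys
    unfolding W_def using that assms by (intro radial_on_mono) (auto simp: admissible_def)
  have restrict: "finite_qderiv x zs a = finite_qderiv x ys a"
    if "admissible ys" "admissible zs" "set ys \<subseteq> set zs" "a \<in> W ys" for ys zs a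
    using compatible that unfolding admissible_def W_def by blast
  have PiE: "finite_qderiv x ys a \<in> W ys" if "admissible ys" "a \<in> W ys" for ys a
    using that radial_frame.finite_qderiv_PiE[OF frame] unfolding admissible_def W_def by blast
  have linear: "coeff_linear_on (W ys) (finite_qderiv x ys)" if "admissible ys" for ys
    using that radial_frame.finite_qderiv_linear[OF frame] unfolding admissible_def W_def by blast
  \<comment> \<open>Any list carrying \<open>a\<close> may be chosen: two choices agree with the
    operator of a common enlargement.\<close>
  define D where "D = (\<lambda>a \<in> radial_on S. finite_qderiv x (SOME ys. admissible ys \<and> a \<in> W ys) a)"
  have D: "D a = finite_qderiv x ys a" if a: "admissible ys" "a \<in> W ys" for ys a
  proof -
    let ?ys = "SOME ys. admissible ys \<and> a \<in> W ys"
    have ys: "admissible ?ys" "a \<in> W ?ys"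
      using someI[of "\<lambda>ys. admissible ys \<and> a \<in> W ys" ys] a by simp_all
    obtain zs where "admissible zs" "set ?ys \<subseteq> set zs" "set ys \<subseteq> set zs"
      using join[OF ys(1) a(1)] by blast
    then have "finite_qderiv x ?ys a = finite_qderiv x ys a"
      using restrict[of _ zs a] ys a by metis
    then show ?thesis
      using a W_S by (auto simp: D_def)
  qed
  have "D a \<in> radial_on S" if "a \<in> radial_on S" for a
    using cover[OF that] D PiE W_S by fastforce
  then have D_PiE: "D \<in> radial_on S \<rightarrow>\<^sub>E radial_on S"
    by (auto simp: D_def)
  have D_linear: "coeff_linear_on (radial_on S) D"
    unfolding coeff_linear_on_def
  proof (intro conjI ballI allI)
    fix a b :: "(coeff, 'v) radial"
    assume "a \<in> radial_on S" "b \<in> radial_on S"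
    then obtain ys ys' where "admissible ys" "a \<in> W ys" "admissible ys'" "b \<in> W ys'"
      using cover by blast
    \<comment> \<open>The two summands may live on different variables; on a common enlargement
      additivity is that of one finite operator.\<close>
    then obtain zs where zs: "admissible zs" "a \<in> W zs" "b \<in> W zs"
      using join W_mono by metis
    then have "a + b \<in> W zs"
      unfolding W_def radial_on_def by (intro subalg.add)
    then show "D (a + b) = D a + D b"
      using zs linear[OF zs(1)] by (simp add: D[OF zs(1)] coeff_linear_on_def)
  next
    fix c and a :: "(coeff, 'v) radial"
    assume "a \<in> radial_on S"
    then obtain ys where ys: "admissible ys" "a \<in> W ys"
      using cover by blast
    then have "scal c * a \<in> W ys"
      unfolding W_def radial_on_def by (intro subalg.mult subalg.scal)
    then show "D (scal c * a) = scal c * D a"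
      using ys linear[OF ys(1)] by (simp add: D[OF ys(1)] coeff_linear_on_def)
  qed
  have D_unique: "D' = D" if D': "D' \<in> radial_on S \<rightarrow>\<^sub>E radial_on S"
    "\<forall>ys. admissible ys \<longrightarrow> (\<forall>a \<in> W ys. D' a = finite_qderiv x ys a)" for D'
  proof (rule PiE_ext[OF D'(1) D_PiE])
    fix a :: "(coeff, 'v) radial"
    assume "a \<in> radial_on S"
    then obtain ys where "admissible ys" "a \<in> W ys"
      using cover by blast
    then show "D' a = D a"
      using D D'(2) by simp
  qed
  have "\<exists>!D. D \<in> radial_on S \<rightarrow>\<^sub>E radial_on S \<and> coeff_linear_on (radial_on S) D \<and>
      (\<forall>ys. admissible ys \<longrightarrow> (\<forall>a \<in> W ys. D a = finite_qderiv x ys a))"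
    by (rule ex1I[of _ D]) (intro conjI D_PiE D_linear allI impI ballI D, assumption+, elim conjE, rule D_unique)
  then show "\<exists>!D. D \<in> radial_on S \<rightarrow>\<^sub>E radial_on S \<and> coeff_linear_on (radial_on S) D \<and>
      (\<forall>ys. distinct ys \<and> set ys \<subseteq> S - {x} \<longrightarrow>
        (\<forall>a \<in> radial_on (insert x (set ys)). D a = finite_qderiv x ys a))"
    unfolding admissible_def W_def .
qed

end
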